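(* Every finite nilpotent Mal'cev algebra $\mathbf{A}$ has a supernilpotent Mal'cev algebra as polynomial reduct; that is, there is a supernilpotent Mal'cev algebra $(A,G)$ on the universe $A$ of $\mathbf{A}$ such that every operation in $G$ is a polynomial operation of $\mathbf{A}$.
   Context: An algebra $\mathbf{A}=(A,F)$ is a set $A$ with a list $F$ of basic operations. A term operation of $\mathbf{A}$ is a finitary operation on $A$ obtained by composing basic operations and projections; a polynomial operation is obtained by composing basic operations, projections and constants. An algebra $(A,G)$ is a polynomial reduct of $\mathbf{A}$ if every operation in $G$ is a polynomial operation of $\mathbf{A}$. An algebra is a Mal'cev algebra if it has a ternary term operation $m$ with $m(x,y,y)=x=m(y,y,x)$ for all $x,y$. Commutators: for congruences $\alpha_1,\dots,\alpha_n$ ($n\ge 2$) of an algebra $\mathbf{A}$, the ($n$-ary, term condition) commutator $[\alpha_1,\dots,\alpha_n]$ is the smallest congruence $\delta$ such that for all polynomial operations $f$ of $\mathbf{A}$ (with variables split into $n$ blocks) and all tuples $a_i,b_i$ of the corresponding block lengths that are coordinatewise congruent modulo $\alpha_i$: if $f(x_1,\dots,x_{n-1},a_n)\equiv_\delta f(x_1,\dots,x_{n-1},b_n)$ for all $(x_1,\dots,x_{n-1})\in\prod_{i<n}\{a_i,b_i\}$ different from $(b_1,\dots,b_{n-1})$, then $f(b_1,\dots,b_{n-1},a_n)\equiv_\delta f(b_1,\dots,b_{n-1},b_n)$. Let $0_A$ be equality and $1_A$ the total congruence. $\mathbf{A}$ is nilpotent if for some $k\ge 1$ there are congruences $1_A=\alpha_0\ge\alpha_1\ge\dots\ge\alpha_k=0_A$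 with $[\alpha_i,1_A]\le\alpha_{i+1}$ for all $i<k$. $\mathbf{A}$ is supernilpotent if for some $k\ge 1$ the $(k+1)$-ary commutator $[1_A,\dots,1_A]$ equals $0_A$. *)

theory Defs
  imports Main "HOL-Library.FuncSet" "HOL-Library.NList"
begin

text \<open>
  An algebra consists of a carrier \<open>A\<close> and a set \<open>F\<close> of pairs \<open>(n, f)\<close>, where \<open>f\<close> is an operation
  on \<open>A\<close> of arity \<open>n\<close>. The elements of \<open>A\<^sup>n\<close> are lists of length \<open>n\<close>, and operations are
  extensional (\<open>undefined\<close> outside \<open>nlists n A\<close>), so that two operations on \<open>A\<close> of equal arity are
  equal iff they agree on \<open>A\<close>. \<open>F\<close> may be infinite, and nullary operations and the empty carrier
  are allowed. Indexing the basic operations plays no role, so a set replaces the list of operations.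
\<close>

type_synonym 'a operation = "nat \<times> ('a list \<Rightarrow> 'a)"

definition is_algebra :: "'a set \<Rightarrow> 'a operation set \<Rightarrow> bool" where
  "is_algebra A F \<longleftrightarrow> (\<forall>(n, f) \<in> F. f \<in> nlists n A \<rightarrow>\<^sub>E A)"

inductive_set term_operations :: "'a set \<Rightarrow> 'a operation set \<Rightarrow> 'a operation set"
  for A :: "'a set" and F :: "'a operation set" where
  basic: "p \<in> F \<Longrightarrow> p \<in> term_operations A F"
| proj: "i < n \<Longrightarrow> (n, \<lambda>xs\<in>nlists n A. xs ! i) \<in> term_operations A F"
| comp: "(k, f) \<in> term_operations A F \<Longrightarrow> length gs = k \<Longrightarrow>
    \<forall>g\<in>set gs. (n, g) \<in> term_operations A F \<Longrightarrow>
    (n, \<lambda>xs\<in>nlists n A. f (map (\<lambda>g. g xs) gs)) \<in> term_operations A F"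

text \<open>
  Constants are added as nullary operations; the rule \<open>comp\<close> with \<open>gs = []\<close> turns them into constant
  operations of every arity.
\<close>

definition constant_operations :: "'a set \<Rightarrow> 'a operation set" where
  "constant_operations A = {(0, \<lambda>xs\<in>nlists 0 A. c) | c. c \<in> A}"

definition polynomial_operations :: "'a set \<Rightarrow> 'a operation set \<Rightarrow> 'a operation set" where
  "polynomial_operations A F = term_operations A (F \<union> constant_operations A)"

definition polynomial_reduct :: "'a set \<Rightarrow> 'a operation set \<Rightarrow> 'a operation set \<Rightarrow> bool" where
  "polynomial_reduct A F G \<longleftrightarrow> is_algebra A G \<and> G \<subseteq> polynomial_operations A F"

definition malcev_algebra :: "'a set \<Rightarrow> 'a operation set \<Rightarrow> bool" where
  "malcev_algebra A F \<longleftrightarrow> is_algebra A F \<and>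
    (\<exists>m. (3, m) \<in> term_operations A F \<and> (\<forall>x\<in>A. \<forall>y\<in>A. m [x, y, y] = x \<and> m [y, y, x] = x))"

definition congruence :: "'a set \<Rightarrow> 'a operation set \<Rightarrow> 'a rel \<Rightarrow> bool" where
  "congruence A F \<theta> \<longleftrightarrow> equiv A \<theta> \<and>
    (\<forall>(n, f) \<in> F. \<forall>xs\<in>nlists n A. \<forall>ys\<in>nlists n A.
       list_all2 (\<lambda>x y. (x, y) \<in> \<theta>) xs ys \<longrightarrow> (f xs, f ys) \<in> \<theta>)"

text \<open>
  The argument tuple whose \<open>i\<close>-th block is \<open>b\<^sub>i\<close> for \<open>i \<in> S\<close> and \<open>a\<^sub>i\<close> otherwise.
\<close>

definition select_blocks :: "'a list list \<Rightarrow> 'a list list \<Rightarrow> nat set \<Rightarrow> 'a list" where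
  "select_blocks as bs S = concat (map (\<lambda>i. if i \<in> S then bs ! i else as ! i) [0..<length as])"

text \<open>
  The term condition for congruences \<open>\<alpha>\<^sub>0, \<dots>, \<alpha>\<^sub>n\<^sub>-\<^sub>1\<close>, given as a list, and \<open>\<delta>\<close>. The tuples
  \<open>(x\<^sub>0, \<dots>, x\<^sub>n\<^sub>-\<^sub>2)\<close> with \<open>x\<^sub>i\<close> among \<open>a\<^sub>i, b\<^sub>i\<close>, other than \<open>(b\<^sub>0, \<dots>, b\<^sub>n\<^sub>-\<^sub>2)\<close>, are understood as choices
  of \<open>a\<^sub>i\<close> or \<open>b\<^sub>i\<close> at each position, other than choosing \<open>b\<^sub>i\<close> everywhere. This matters only if
  \<open>a\<^sub>i = b\<^sub>i\<close> for some \<open>i < n - 1\<close>, when the condition must be vacuous: comparing the tuples by value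
  instead would leave no hypothesis if all these \<open>a\<^sub>i = b\<^sub>i\<close>, forcing every commutator to contain
  its last argument.
\<close>

definition centralizes :: "'a set \<Rightarrow> 'a operation set \<Rightarrow> 'a rel list \<Rightarrow> 'a rel \<Rightarrow> bool" where
  "centralizes A F \<alpha>s \<delta> \<longleftrightarrow> (let n = length \<alpha>s in
    \<forall>f as bs. length as = n \<longrightarrow> length bs = n \<longrightarrow>
      (\<forall>i<n. list_all2 (\<lambda>x y. (x, y) \<in> \<alpha>s ! i) (as ! i) (bs ! i)) \<longrightarrow>
      (sum_list (map length as), f) \<in> polynomial_operations A F \<longrightarrow>
      (\<forall>S. S \<subset> {..<n - 1} \<longrightarrow>
         (f (select_blocks as bs S), f (select_blocks as bs (insert (n - 1) S))) \<in> \<delta>) \<longrightarrow>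
      (f (select_blocks as bs {..<n - 1}), f (select_blocks as bs {..<n})) \<in> \<delta>)"

definition commutator :: "'a set \<Rightarrow> 'a operation set \<Rightarrow> 'a rel list \<Rightarrow> 'a rel" where
  "commutator A F \<alpha>s = \<Inter>{\<delta>. congruence A F \<delta> \<and> centralizes A F \<alpha>s \<delta>}"

definition nilpotent :: "'a set \<Rightarrow> 'a operation set \<Rightarrow> bool" where
  "nilpotent A F \<longleftrightarrow> (\<exists>k\<ge>1. \<exists>\<alpha> :: nat \<Rightarrow> 'a rel.
     (\<forall>i\<le>k. congruence A F (\<alpha> i)) \<and> \<alpha> 0 = A \<times> A \<and> \<alpha> k = Id_on A \<and>
     (\<forall>i<k. \<alpha> (Suc i) \<subseteq> \<alpha> i \<and> commutator A F [\<alpha> i, A \<times> A] \<subseteq> \<alpha> (Suc i)))"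

definition supernilpotent :: "'a set \<Rightarrow> 'a operation set \<Rightarrow> bool" where
  "supernilpotent A F \<longleftrightarrow> (\<exists>k\<ge>1. commutator A F (replicate (k + 1) (A \<times> A)) = Id_on A)"


text \<open>
  The intersection defining the commutator is indeed the smallest congruence with the term condition.
\<close>

lemma term_operations_closed:
  assumes "is_algebra A F" "p \<in> term_operations A F"
  shows "snd p \<in> nlists (fst p) A \<rightarrow>\<^sub>E A"
  using assms(2)
proof induction
  case (basic p)
  then show ?case using assms(1) by (auto simp: is_algebra_def split_beta)
next
  case (proj i n)
  then show ?case by (auto simp: nlistsE_nth_in)
next
  case (comp k f gs n)
  have "map (\<lambda>g. g xs) gs \<in> nlists k A" if "xs \<in> nlists n A" for xs
    using comp that by (intro nlistsI) auto
  with comp show ?case by auto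
qed

lemma is_algebra_constants:
  "is_algebra A F \<Longrightarrow> is_algebra A (F \<union> constant_operations A)"
  by (auto simp: is_algebra_def constant_operations_def)

lemma polynomial_operations_closed:
  "is_algebra A F \<Longrightarrow> (n, f) \<in> polynomial_operations A F \<Longrightarrow> f \<in> nlists n A \<rightarrow>\<^sub>E A"
  unfolding polynomial_operations_def
  using term_operations_closed[OF is_algebra_constants, of A F "(n, f)"] by simp

lemma congruence_total: "is_algebra A F \<Longrightarrow> congruence A F (A \<times> A)"
  unfolding congruence_def is_algebra_def equiv_def refl_on_def sym_def trans_def by fastforce

lemma select_blocks_in_nlists:
  assumes "length bs = length as"
    and "\<And>i. i < length as \<Longrightarrow> list_all2 (\<lambda>x y. (x, y) \<in> A \<times> A) (as ! i) (bs ! i)"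
  shows "select_blocks as bs S \<in> nlists (sum_list (map length as)) A"
proof (rule nlistsI)
  have "map length (map (\<lambda>i. if i \<in> S then bs ! i else as ! i) [0..<length as]) = map length as"
    using list_all2_lengthD[OF assms(2)] by (intro nth_equalityI) auto
  then show "length (select_blocks as bs S) = sum_list (map length as)"
    unfolding select_blocks_def length_concat by simp
  show "set (select_blocks as bs S) \<subseteq> A"
    using assms(2) by (fastforce simp: select_blocks_def list_all2_conv_all_nth in_set_conv_nth split: if_splits)
qed

lemma centralizes_total:
  assumes "is_algebra A F" "\<forall>\<alpha>\<in>set \<alpha>s. congruence A F \<alpha>"
  shows "centralizes A F \<alpha>s (A \<times> A)"
  unfolding centralizes_def Let_def
proof (intro allI impI)
  fix f as bs
  assume len: "length as = length \<alpha>s" "length bs = length \<alpha>s"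
    and rel: "\<forall>i<length \<alpha>s. list_all2 (\<lambda>x y. (x, y) \<in> \<alpha>s ! i) (as ! i) (bs ! i)"
    and f: "(sum_list (map length as), f) \<in> polynomial_operations A F"
  have "\<alpha>s ! i \<subseteq> A \<times> A" if "i < length \<alpha>s" for i
    using assms(2) that by (auto simp: congruence_def equiv_def dest!: nth_mem)
  then have "list_all2 (\<lambda>x y. (x, y) \<in> A \<times> A) (as ! i) (bs ! i)" if "i < length as" for i
    using rel len that by (metis (no_types, lifting) list_all2_mono subsetD)
  then have "f (select_blocks as bs S) \<in> A" for S
    using select_blocks_in_nlists[of bs as A S] len polynomial_operations_closed[OF assms(1) f]
    by auto
  then show "(f (select_blocks as bs {..<length \<alpha>s - 1}), f (select_blocks as bs {..<length \<alpha>s})) \<in> A \<times> A"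
    by simp
qed

lemma commutator_least:
  assumes "congruence A F \<delta>" "centralizes A F \<alpha>s \<delta>"
  shows "commutator A F \<alpha>s \<subseteq> \<delta>"
  using assms by (auto simp: commutator_def)

lemma centralizes_commutator: "centralizes A F \<alpha>s (commutator A F \<alpha>s)"
  unfolding commutator_def centralizes_def Let_def by blast

lemma congruence_commutator:
  assumes "is_algebra A F" "\<forall>\<alpha>\<in>set \<alpha>s. congruence A F \<alpha>"
  shows "congruence A F (commutator A F \<alpha>s)"
proof -
  let ?D = "{\<delta>. congruence A F \<delta> \<and> centralizes A F \<alpha>s \<delta>}"
  have tot: "A \<times> A \<in> ?D"
    using assms centralizes_total congruence_total by blast
  have eq: "\<And>\<delta>. \<delta> \<in> ?D \<Longrightarrow> equiv A \<delta>" by (simp add: congruence_def)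
  have "equiv A (\<Inter>?D)"
  proof (rule equivI)
    show "\<Inter>?D \<subseteq> A \<times> A" using tot by blast
    show "refl_on A (\<Inter>?D)" using eq unfolding equiv_def refl_on_def by blast
    show "sym (\<Inter>?D)" using eq unfolding equiv_def sym_def by blast
    show "trans (\<Inter>?D)" using eq unfolding equiv_def trans_def by blast
  qed
  moreover have "(f xs, f ys) \<in> \<delta>"
    if "(n, f) \<in> F" "xs \<in> nlists n A" "ys \<in> nlists n A"
      "list_all2 (\<lambda>x y. (x, y) \<in> \<Inter>?D) xs ys" "\<delta> \<in> ?D" for n f xs ys \<delta>
  proof -
    have "list_all2 (\<lambda>x y. (x, y) \<in> \<delta>) xs ys"
      using that(4) by (rule list_all2_mono) (use that(5) in blast)
    with that show ?thesis unfolding congruence_def by blast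
  qed
  ultimately show ?thesis unfolding commutator_def congruence_def[of A F "\<Inter>?D"] by blast
qed

end

theory Submission
  imports Defs "HOL-Number_Theory.Residues"
begin

text \<open>
  The reduct has a single basic operation, a Mal'cev operation that does not mix the primes.

  Let \<open>m\<close> be a Mal'cev term of the nilpotent algebra. A central series can be refined, as far as
  congruences of \<open>m\<close> are concerned, until every factor has prime order
  (\<open>exists_maximal_central\<close>, \<open>prime_period\<close>). This gives coordinates \<open>\<phi> i\<close> on \<open>A\<close> with values modulo
  primes \<open>p i\<close>, which together separate points and satisfy
  \<open>\<phi> i (m x y z) = \<phi> i x - \<phi> i y + \<phi> i z + c i\<close>, where \<open>c i\<close> depends on the coordinates of \<open>x\<close>, \<open>y\<close>,
  \<open>z\<close> before \<open>i\<close> only (\<open>exists_coordinates\<close>).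

  If \<open>c i\<close> depended only on preceding coordinates for the same prime \<open>p i\<close>, the algebra \<open>(A, m)\<close>
  would be supernilpotent. Indeed a function between powers of the field with \<open>p\<close> elements is a
  polynomial, so by induction on \<open>i\<close> the coordinate \<open>i\<close> of a polynomial operation has a degree that
  is bounded independently of the operation and its arity (\<open>bounded_degree\<close>). A function of degree
  at most \<open>d\<close> has vanishing alternating sums over cubes of more than \<open>d\<close> blocks, and this is the term
  condition for the commutator of more than \<open>d\<close> total congruences (\<open>centralizes_Id\<close>).

  It remains to replace \<open>m\<close> by such an operation. Fix an element \<open>u\<close> and read \<open>m x u y\<close> as a sum. A
  suitable multiple of \<open>x\<close> has slope \<open>1\<close> in the coordinates of order \<open>q\<close> and slope \<open>0\<close> in the others.
  An idempotent power of this map is a polynomial retraction \<open>e q\<close> of \<open>A\<close>, on whose range the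
  coordinates of order \<open>q\<close> determine everything (\<open>exists_retraction\<close>, \<open>agree_range\<close>). An element of \<open>A\<close>
  is determined by its images under the retractions, and these images can be prescribed by a
  polynomial (\<open>newton_agree\<close>). So there is a polynomial operation \<open>s\<close> with
  \<open>e q (s x y z) = e q (m (e q x) (e q y) (e q z))\<close> for all \<open>q\<close>. This \<open>s\<close> is Mal'cev, and with respect
  to the coordinates \<open>\<phi> i (e (p i) x)\<close> it does not mix primes.
\<close>

section \<open>Polynomial operations of a Mal'cev operation\<close>

locale malcev =
  fixes A :: "'a set" and m :: "'a \<Rightarrow> 'a \<Rightarrow> 'a \<Rightarrow> 'a"
  assumes m_closed [simp, intro]: "x \<in> A \<Longrightarrow> y \<in> A \<Longrightarrow> z \<in> A \<Longrightarrow> m x y z \<in> A"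
    and m_right [simp]: "x \<in> A \<Longrightarrow> y \<in> A \<Longrightarrow> m x y y = x"
    and m_left [simp]: "x \<in> A \<Longrightarrow> y \<in> A \<Longrightarrow> m y y x = x"
begin

text \<open>
  Polynomial operations with \<open>m\<close> as the only basic operation, up to values outside the carrier. Only
  \<open>m\<close> is applied at the root, so that induction follows the term, whereas the composition rule of
  \<open>term_operations\<close> would compose two operations of unknown degree.
\<close>

inductive pol :: "nat \<Rightarrow> ('a list \<Rightarrow> 'a) \<Rightarrow> bool" for N where
  pol_proj: "i < N \<Longrightarrow> pol N (\<lambda>xs. xs ! i)"
| pol_const: "c \<in> A \<Longrightarrow> pol N (\<lambda>xs. c)"
| pol_m: "pol N f \<Longrightarrow> pol N g \<Longrightarrow> pol N h \<Longrightarrow> pol N (\<lambda>xs. m (f xs) (g xs) (h xs))"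

lemma pol_closed: "pol N f \<Longrightarrow> xs \<in> nlists N A \<Longrightarrow> f xs \<in> A"
  by (induction rule: pol.induct) (auto simp: nlistsE_nth_in)

lemma pol_subst:
  assumes "pol N f" "length gs = N" "\<forall>g\<in>set gs. pol M g"
  shows "pol M (\<lambda>xs. f (map (\<lambda>g. g xs) gs))"
  using assms(1)
proof (induction rule: pol.induct)
  case (pol_proj i)
  then have "pol M (gs ! i)" using assms(2,3) by simp
  then have "pol M (\<lambda>xs. (gs ! i) xs)" by simp
  then show ?case using pol_proj assms(2) by simp
qed (auto intro: pol.intros)

lemma pol_imp_polynomial:
  assumes m0: "(3, m0) \<in> term_operations A F"
    and m: "\<And>x y z. x \<in> A \<Longrightarrow> y \<in> A \<Longrightarrow> z \<in> A \<Longrightarrow> m x y z = m0 [x, y, z]"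
    and "pol N f"
  shows "(N, \<lambda>xs\<in>nlists N A. f xs) \<in> polynomial_operations A F"
  using assms(3)
proof (induction rule: pol.induct)
  case (pol_proj i)
  then show ?case unfolding polynomial_operations_def by (rule term_operations.proj)
next
  case (pol_const c)
  have "(0, \<lambda>xs\<in>nlists 0 A. c) \<in> term_operations A (F \<union> constant_operations A)"
    using pol_const by (intro term_operations.basic) (auto simp: constant_operations_def)
  from term_operations.comp[OF this, of "[]" N]
  show ?case unfolding polynomial_operations_def by (simp add: restrict_def)
next
  case (pol_m f g h)
  have mono: "p \<in> term_operations A F \<Longrightarrow> p \<in> term_operations A (F \<union> C)" for p C
    by (induction rule: term_operations.induct)
      (auto intro: term_operations.intros)
  let ?r = "\<lambda>f. \<lambda>xs\<in>nlists N A. f xs"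
  have "(N, \<lambda>xs\<in>nlists N A. m0 (map (\<lambda>g. g xs) [?r f, ?r g, ?r h])) \<in> polynomial_operations A F"
    unfolding polynomial_operations_def
  proof (rule term_operations.comp[OF mono[OF m0]])
    show "\<forall>g\<in>set [?r f, ?r g, ?r h]. (N, g) \<in> term_operations A (F \<union> constant_operations A)"
      using pol_m.IH unfolding polynomial_operations_def list.set ball_simps by blast
  qed simp
  also have "(\<lambda>xs\<in>nlists N A. m0 (map (\<lambda>g. g xs) [?r f, ?r g, ?r h]))
      = (\<lambda>xs\<in>nlists N A. m (f xs) (g xs) (h xs))"
    using pol_m.hyps by (intro restrict_ext) (simp add: m pol_closed)
  finally show ?case .
qed

text \<open>
  Stated for all substituted operations \<open>gs\<close>, the claim passes through a composition: substitute
  \<open>gs\<close> into the inner operations first, and then their results into the outer one.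
\<close>

lemma polynomial_subst_pol:
  assumes m0: "\<And>x y z. x \<in> A \<Longrightarrow> y \<in> A \<Longrightarrow> z \<in> A \<Longrightarrow> m0 [x, y, z] = m x y z"
    and p: "p \<in> term_operations A ({(3, m0)} \<union> constant_operations A)"
  shows "\<forall>gs M. length gs = fst p \<longrightarrow> (\<forall>g\<in>set gs. pol M g) \<longrightarrow>
      (\<exists>h. pol M h \<and> (\<forall>xs\<in>nlists M A. snd p (map (\<lambda>g. g xs) gs) = h xs))"
  using p
proof (induction rule: term_operations.induct)
  case (basic p)
  show ?case
  proof (intro allI impI)
    fix gs :: "('a list \<Rightarrow> 'a) list" and M
    assume prems: "length gs = fst p" "\<forall>g\<in>set gs. pol M g"
    show "\<exists>h. pol M h \<and> (\<forall>xs\<in>nlists M A. snd p (map (\<lambda>g. g xs) gs) = h xs)"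
    proof (cases "p = (3, m0)")
      case True
      with prems have "length gs = 3" by simp
      then obtain a b c where gs: "gs = [a, b, c]"
        by (auto simp: numeral_3_eq_3 length_Suc_conv)
      have "pol M (\<lambda>xs. m (a xs) (b xs) (c xs))"
        using prems gs by (intro pol_m) auto
      moreover have "m0 [a xs, b xs, c xs] = m (a xs) (b xs) (c xs)" if "xs \<in> nlists M A" for xs
        using prems gs pol_closed[OF _ that] by (intro m0) simp_all
      ultimately show ?thesis using True gs by auto
    next
      case False
      with basic obtain c where "c \<in> A" "p = (0, \<lambda>xs\<in>nlists 0 A. c)"
        by (auto simp: constant_operations_def)
      with prems pol_const[of c M] show ?thesis by auto
    qed
  qed
next
  case (proj i n)
  show ?case
  proof (intro allI impI)
    fix gs :: "('a list \<Rightarrow> 'a) list" and M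
    assume prems: "length gs = fst (n, \<lambda>xs\<in>nlists n A. xs ! i)" "\<forall>g\<in>set gs. pol M g"
    have "map (\<lambda>g. g xs) gs \<in> nlists n A" if "xs \<in> nlists M A" for xs
      using prems pol_closed[OF _ that] by (intro nlistsI) auto
    with proj prems
    show "\<exists>h. pol M h \<and> (\<forall>xs\<in>nlists M A. snd (n, \<lambda>xs\<in>nlists n A. xs ! i) (map (\<lambda>g. g xs) gs)
      = h xs)"
      by (intro exI[of _ "gs ! i"]) auto
  qed
next
  case (comp k f fs n)
  let ?c = "\<lambda>xs\<in>nlists n A. f (map (\<lambda>g. g xs) fs)"
  show ?case
  proof (intro allI impI)
    fix gs :: "('a list \<Rightarrow> 'a) list" and M
    assume "length gs = fst (n, ?c)" and gs: "\<forall>g\<in>set gs. pol M g"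
    then have len: "length gs = n" by simp
    have "\<exists>h. pol M h \<and> (\<forall>xs\<in>nlists M A. f' (map (\<lambda>g. g xs) gs) = h xs)" if "f' \<in> set fs" for f'
      using comp.IH(2) len gs that by simp
    then obtain H where H: "\<And>f'. f' \<in> set fs \<Longrightarrow>
        pol M (H f') \<and> (\<forall>xs\<in>nlists M A. f' (map (\<lambda>g. g xs) gs) = H f' xs)"
      by metis
    obtain h where h: "pol M h" "\<And>xs. xs \<in> nlists M A \<Longrightarrow> f (map (\<lambda>g. g xs) (map H fs)) = h xs"
      using comp.IH(1)[THEN spec, THEN spec, of "map H fs" M] H comp.hyps by auto
    have "?c (map (\<lambda>g. g xs) gs) = h xs" if "xs \<in> nlists M A" for xs
    proof -
      have eq: "map (\<lambda>f'. f' (map (\<lambda>g. g xs) gs)) fs = map (\<lambda>g. g xs) (map H fs)"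
        using H that by simp
      have "map (\<lambda>g. g xs) gs \<in> nlists n A"
        using len gs pol_closed[OF _ that] by (intro nlistsI) auto
      then have "?c (map (\<lambda>g. g xs) gs) = f (map (\<lambda>f'. f' (map (\<lambda>g. g xs) gs)) fs)"
        by (rule restrict_apply')
      also have "\<dots> = f (map (\<lambda>g. g xs) (map H fs))" by (simp only: eq)
      also have "\<dots> = h xs" using that by (rule h(2))
      finally show ?thesis .
    qed
    then have "\<forall>xs\<in>nlists M A. ?c (map (\<lambda>g. g xs) gs) = h xs"
      by (rule ballI)
    with h(1) show "\<exists>h. pol M h \<and> (\<forall>xs\<in>nlists M A. snd (n, ?c) (map (\<lambda>g. g xs) gs) = h xs)"
      unfolding snd_conv by (rule_tac x = h in exI) (rule conjI)
  qed
qed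

lemma polynomial_imp_pol:
  assumes m0: "\<And>x y z. x \<in> A \<Longrightarrow> y \<in> A \<Longrightarrow> z \<in> A \<Longrightarrow> m0 [x, y, z] = m x y z"
    and f: "(N, f) \<in> polynomial_operations A {(3, m0)}"
  shows "\<exists>h. pol N h \<and> (\<forall>xs\<in>nlists N A. f xs = h xs)"
proof -
  let ?gs = "map (\<lambda>i xs. xs ! i) [0..<N]"
  have id: "map (\<lambda>g. g xs) ?gs = xs" if "xs \<in> nlists N A" for xs :: "'a list"
  proof -
    have N: "N = length xs" using nlistsE_length[OF that] by simp
    show ?thesis unfolding map_map comp_def N by (rule map_nth)
  qed
  have gs: "length ?gs = fst (N, f)" "\<forall>g\<in>set ?gs. pol N g" by (simp_all add: pol_proj)
  have "\<exists>h. pol N h \<and> (\<forall>xs\<in>nlists N A. snd (N, f) (map (\<lambda>g. g xs) ?gs) = h xs)"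
    by (rule polynomial_subst_pol[of m0 "(N, f)", OF _ f[unfolded polynomial_operations_def],
          rule_format, OF _ gs(1)]) (rule m0, assumption+, use gs(2) in blast)
  then obtain h where h: "pol N h" "\<And>xs. xs \<in> nlists N A \<Longrightarrow> f (map (\<lambda>g. g xs) ?gs) = h xs"
    by (elim exE conjE) (rule that, simp_all only: snd_conv)
  have "f xs = h xs" if "xs \<in> nlists N A" for xs
    using h(2)[OF that] unfolding id[OF that] .
  then have "\<forall>xs\<in>nlists N A. f xs = h xs" by (rule ballI)
  with h(1) show ?thesis by (rule_tac x = h in exI) (rule conjI)
qed

section \<open>Central pairs of congruences\<close>

definition cong_m :: "'a rel \<Rightarrow> bool" where
  "cong_m \<theta> \<longleftrightarrow> equiv A \<theta> \<and> (\<forall>x x' y y' z z'. (x, x') \<in> \<theta> \<longrightarrow> (y, y') \<in> \<theta> \<longrightarrow> (z, z') \<in> \<theta> \<longrightarrow>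
     (m x y z, m x' y' z') \<in> \<theta>)"

lemma cong_mI:
  assumes "\<And>x y. (x, y) \<in> \<theta> \<Longrightarrow> x \<in> A \<and> y \<in> A" "\<And>x. x \<in> A \<Longrightarrow> (x, x) \<in> \<theta>"
    "\<And>x y. (x, y) \<in> \<theta> \<Longrightarrow> (y, x) \<in> \<theta>"
    "\<And>x y z. (x, y) \<in> \<theta> \<Longrightarrow> (y, z) \<in> \<theta> \<Longrightarrow> (x, z) \<in> \<theta>"
    "\<And>x x' y y' z z'. (x, x') \<in> \<theta> \<Longrightarrow> (y, y') \<in> \<theta> \<Longrightarrow> (z, z') \<in> \<theta> \<Longrightarrow> (m x y z, m x' y' z') \<in> \<theta>"
  shows "cong_m \<theta>"
proof -
  have "equiv A \<theta>"
  proof (rule equivI)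
    show "\<theta> \<subseteq> A \<times> A" using assms(1) by auto
    show "refl_on A \<theta>" using assms(2) by (auto simp: refl_on_def)
    show "sym \<theta>" using assms(3) by (rule symI)
    show "trans \<theta>" using assms(4) by (rule transI)
  qed
  then show ?thesis unfolding cong_m_def using assms(5) by simp
qed

lemma cong_mD:
  assumes "cong_m \<theta>"
  shows cong_m_in: "(x, y) \<in> \<theta> \<Longrightarrow> x \<in> A \<and> y \<in> A"
    and cong_m_refl: "x \<in> A \<Longrightarrow> (x, x) \<in> \<theta>"
    and cong_m_sym: "(x, y) \<in> \<theta> \<Longrightarrow> (y, x) \<in> \<theta>"
    and cong_m_trans: "(x, y) \<in> \<theta> \<Longrightarrow> (y, z) \<in> \<theta> \<Longrightarrow> (x, z) \<in> \<theta>"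
    and cong_m_m: "(x, x') \<in> \<theta> \<Longrightarrow> (y, y') \<in> \<theta> \<Longrightarrow> (z, z') \<in> \<theta> \<Longrightarrow> (m x y z, m x' y' z') \<in> \<theta>"
proof -
  have e: "equiv A \<theta>" using assms unfolding cong_m_def by simp
  show "(x, y) \<in> \<theta> \<Longrightarrow> x \<in> A \<and> y \<in> A" using e unfolding equiv_def by auto
  show "x \<in> A \<Longrightarrow> (x, x) \<in> \<theta>" using e unfolding equiv_def refl_on_def by auto
  show "(x, y) \<in> \<theta> \<Longrightarrow> (y, x) \<in> \<theta>" using e by (metis equivE symD)
  show "(x, y) \<in> \<theta> \<Longrightarrow> (y, z) \<in> \<theta> \<Longrightarrow> (x, z) \<in> \<theta>" using e by (metis equivE transD)
  show "(x, x') \<in> \<theta> \<Longrightarrow> (y, y') \<in> \<theta> \<Longrightarrow> (z, z') \<in> \<theta> \<Longrightarrow> (m x y z, m x' y' z') \<in> \<theta>"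
    using assms unfolding cong_m_def by simp
qed

lemma cong_m_Int:
  assumes "cong_m \<theta>" "cong_m \<theta>'"
  shows "cong_m (\<theta> \<inter> \<theta>')"
proof (rule cong_mI; (elim IntE)?)
  fix x y assume "(x, y) \<in> \<theta>" "(x, y) \<in> \<theta>'"
  then show "x \<in> A \<and> y \<in> A" "(y, x) \<in> \<theta> \<inter> \<theta>'"
    using assms cong_m_in cong_m_sym by (blast, blast)
next
  fix x y z assume "(x, y) \<in> \<theta>" "(x, y) \<in> \<theta>'" "(y, z) \<in> \<theta>" "(y, z) \<in> \<theta>'"
  then show "(x, z) \<in> \<theta> \<inter> \<theta>'"
    using cong_m_trans[OF assms(1), of x y z] cong_m_trans[OF assms(2), of x y z] by simp
qed (simp_all add: cong_m_refl[OF assms(1)] cong_m_refl[OF assms(2)]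
    cong_m_m[OF assms(1)] cong_m_m[OF assms(2)])

lemma pol_cong:
  assumes "cong_m \<theta>" "pol N f" "length xs = N" "list_all2 (\<lambda>x y. (x, y) \<in> \<theta>) xs ys"
  shows "(f xs, f ys) \<in> \<theta>"
  using assms(2)
proof (induction rule: pol.induct)
  case (pol_proj i)
  then show ?case using assms(3,4) by (simp add: list_all2_conv_all_nth)
next
  case (pol_const c)
  then show ?case by (rule cong_m_refl[OF assms(1)])
next
  case (pol_m f g h)
  show ?case using pol_m.IH by (rule cong_m_m[OF assms(1)])
qed

text \<open>
  For congruences \<open>\<theta>\<close> and \<open>\<delta>\<close> this says that \<open>\<theta>\<close> is central modulo \<open>\<delta>\<close>: replacing \<open>a\<close> by \<open>b\<close> changes
  the value of \<open>f\<close> by an amount that is independent of the other arguments. Contrary to the term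
  condition, this form is visibly monotone in \<open>\<delta>\<close>. One moving argument and three others are all that
  the identities between the operation and its translations need.
\<close>

definition central :: "'a rel \<Rightarrow> 'a rel \<Rightarrow> bool" where
  "central \<theta> \<delta> \<longleftrightarrow> (\<forall>f a b x y z x' y' z'. pol 4 f \<longrightarrow> (a, b) \<in> \<theta> \<longrightarrow>
     {x, y, z, x', y', z'} \<subseteq> A \<longrightarrow>
     (f [b, x, y, z], m (f [b, x', y', z']) (f [a, x', y', z']) (f [a, x, y, z])) \<in> \<delta>)"

lemma central_mono: "central \<theta> \<delta> \<Longrightarrow> \<delta> \<subseteq> \<delta>' \<Longrightarrow> central \<theta> \<delta>'"
  unfolding central_def by (intro allI impI) (rule subsetD, assumption, simp)

text \<open>
  The term condition is applied to \<open>m (f w v) (f a v) (f a x)\<close> as a function of \<open>w\<close> and the remaining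
  arguments \<open>v\<close>, which does not depend on \<open>v\<close> for \<open>w = a\<close>.
\<close>

lemma central_of_centralizes:
  assumes m0: "(3, m0) \<in> term_operations A F"
    and m: "\<And>x y z. x \<in> A \<Longrightarrow> y \<in> A \<Longrightarrow> z \<in> A \<Longrightarrow> m x y z = m0 [x, y, z]"
    and \<alpha>: "\<alpha> \<subseteq> A \<times> A" and refl: "refl_on A \<delta>"
    and cz: "centralizes A F [\<alpha>, A \<times> A] \<delta>"
  shows "central \<alpha> \<delta>"
  unfolding central_def
proof (intro allI impI)
  fix f a b x y z x' y' z'
  assume f: "pol 4 f" and ab: "(a, b) \<in> \<alpha>" and A: "{x, y, z, x', y', z'} \<subseteq> A"
  have abA: "a \<in> A" "b \<in> A" using ab \<alpha> by auto
  define g where "g = (\<lambda>xs. m (f xs) (f [a, xs ! 1, xs ! 2, xs ! 3]) (f [a, x, y, z]))"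
  have fA: "f [u1, u2, u3, u4] \<in> A" if "{u1, u2, u3, u4} \<subseteq> A" for u1 u2 u3 u4
    by (rule pol_closed[OF f], rule nlistsI) (use that in simp_all)
  have 1: "pol 4 (\<lambda>xs. f [a, xs ! 1, xs ! 2, xs ! 3])"
    using pol_subst[OF f, of "[\<lambda>_. a, \<lambda>xs. xs ! 1, \<lambda>xs. xs ! 2, \<lambda>xs. xs ! 3]" 4] abA
    by (simp add: pol_proj pol_const)
  have 2: "pol 4 g" unfolding g_def using A abA by (intro pol_m 1 f pol_const fA) simp
  define G where "G = (\<lambda>xs\<in>nlists 4 A. g xs)"
  have gp: "(4, G) \<in> polynomial_operations A F"
    unfolding G_def by (rule pol_imp_polynomial[OF m0 _ 2]) (simp add: m)
  have g_eq: "G [u, v, w, t] = m (f [u, v, w, t]) (f [a, v, w, t]) (f [a, x, y, z])"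
    if "{u, v, w, t} \<subseteq> A" for u v w t
    using that nlistsI[of "[u, v, w, t]" 4 A] by (simp add: g_def G_def)
  let ?as = "[[a], [x, y, z]]" and ?bs = "[[b], [x', y', z']]"
  have sel: "select_blocks ?as ?bs {} = [a, x, y, z]" "select_blocks ?as ?bs {Suc 0}
    = [a, x', y', z']"
    "select_blocks ?as ?bs {0} = [b, x, y, z]" "select_blocks ?as ?bs {0, Suc 0} = [b, x', y', z']"
    by (simp_all add: select_blocks_def)
  have one: "S \<subset> {0} \<longleftrightarrow> S = {}" for S :: "nat set" by auto
  have less: "{..<Suc 0} = {0}" "{..<Suc (Suc 0)} = {0, Suc 0}" by auto
  have gp': "(Suc (Suc (Suc (Suc 0))), G) \<in> polynomial_operations A F"
    using gp by (simp add: eval_nat_numeral)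
  have "(G [a, x, y, z], G [a, x', y', z']) \<in> \<delta>"
    using A abA fA refl by (simp add: g_eq refl_on_def)
  then have "\<forall>S. S \<subset> {0} \<longrightarrow>
      (G (select_blocks ?as ?bs S), G (select_blocks ?as ?bs (insert (Suc 0) S))) \<in> \<delta>"
    by (simp add: one sel)
  moreover have "\<forall>i<Suc (Suc 0). list_all2 (\<lambda>x y. (x, y) \<in> [\<alpha>, A \<times> A] ! i) (?as ! i) (?bs ! i)"
    using A ab by (simp add: All_less_Suc)
  ultimately have "(G [b, x, y, z], G [b, x', y', z']) \<in> \<delta>"
    using cz[unfolded centralizes_def Let_def, THEN spec[of _ G], THEN spec[of _ ?as],
        THEN spec[of _ ?bs]] gp'
    by (simp add: less sel)
  then show "(f [b, x, y, z], m (f [b, x', y', z']) (f [a, x', y', z']) (f [a, x, y, z])) \<in> \<delta>"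
    using A abA fA by (simp add: g_eq)
qed

definition central_chain :: "nat \<Rightarrow> (nat \<Rightarrow> 'a rel) \<Rightarrow> bool" where
  "central_chain k \<alpha> \<longleftrightarrow> (\<forall>i\<le>k. cong_m (\<alpha> i)) \<and> \<alpha> 0 = A \<times> A \<and> \<alpha> k = Id_on A \<and>
     (\<forall>i<k. central (\<alpha> i) (\<alpha> (Suc i)))"

text \<open>
  Intersecting \<open>\<theta>\<close> with the first member of the chain that does not contain it gives a proper
  subcongruence modulo which \<open>\<theta>\<close> is central, and by monotonicity it can be enlarged to a maximal one.
\<close>

lemma exists_maximal_central:
  assumes fin: "finite A"
    and chain: "central_chain k \<alpha>"
    and \<theta>: "cong_m \<theta>" "\<theta> \<noteq> Id_on A"
  obtains \<delta> where "cong_m \<delta>" "\<delta> \<subset> \<theta>" "central \<theta> \<delta>"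
    "\<And>\<delta>'. cong_m \<delta>' \<Longrightarrow> \<delta> \<subseteq> \<delta>' \<Longrightarrow> \<delta>' \<subseteq> \<theta> \<Longrightarrow> \<delta>' = \<delta> \<or> \<delta>' = \<theta>"
proof -
  note chain = chain[unfolded central_chain_def]
  have \<theta>A: "\<theta> \<subseteq> A \<times> A" using \<theta>(1) cong_m_in by auto
  have "\<not> \<theta> \<subseteq> \<alpha> k"
    using \<theta> cong_m_refl[OF \<theta>(1)] chain by (auto simp: Id_on_def)
  then have not_least: "\<not> \<theta> \<subseteq> \<alpha> (LEAST i. \<not> \<theta> \<subseteq> \<alpha> i)" "(LEAST i. \<not> \<theta> \<subseteq> \<alpha> i) \<le> k"
    by (rule LeastI, rule Least_le)
  have "(LEAST i. \<not> \<theta> \<subseteq> \<alpha> i) \<noteq> 0" using not_least(1) \<theta>A chain by metis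
  then obtain j where Suc_j: "(LEAST i. \<not> \<theta> \<subseteq> \<alpha> i) = Suc j" using not0_implies_Suc by blast
  then have j: "j < k" "\<theta> \<subseteq> \<alpha> j" "\<not> \<theta> \<subseteq> \<alpha> (Suc j)"
    using not_least not_less_Least[of j "\<lambda>i. \<not> \<theta> \<subseteq> \<alpha> i"] by auto
  define \<delta>0 where "\<delta>0 = \<alpha> (Suc j) \<inter> \<theta>"
  have c: "cong_m (\<alpha> (Suc j))" using chain j(1) by simp
  have c0: "cong_m \<delta>0" unfolding \<delta>0_def by (rule cong_m_Int[OF c \<theta>(1)])
  have "central \<theta> \<delta>0" unfolding central_def
  proof (intro allI impI)
    fix f a b x y z x' y' z'
    assume f: "pol 4 f" and ab: "(a, b) \<in> \<theta>" and A: "{x, y, z, x', y', z'} \<subseteq> A"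
    have abA: "a \<in> A" "b \<in> A" using ab \<theta>A by auto
    have fA: "f [u1, u2, u3, u4] \<in> A" if "{u1, u2, u3, u4} \<subseteq> A" for u1 u2 u3 u4
      by (rule pol_closed[OF f], rule nlistsI) (use that in simp_all)
    have step: "(f [a, u, v, w], f [b, u, v, w]) \<in> \<theta>" if "{u, v, w} \<subseteq> A" for u v w
      by (rule pol_cong[OF \<theta>(1) f]) (use ab that cong_m_refl[OF \<theta>(1)] in auto)
    have "(m (f [b, x', y', z']) (f [b, x', y', z']) (f [b, x, y, z]),
        m (f [b, x', y', z']) (f [a, x', y', z']) (f [a, x, y, z])) \<in> \<theta>"
      by (rule cong_m_m[OF \<theta>(1) cong_m_refl[OF \<theta>(1)] cong_m_sym[OF \<theta>(1) step]
            cong_m_sym[OF \<theta>(1) step]]) (use A abA fA in simp_all)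
    then have "(f [b, x, y, z], m (f [b, x', y', z']) (f [a, x', y', z']) (f [a, x, y, z])) \<in> \<theta>"
      using fA A abA by simp
    moreover have "(f [b, x, y, z], m (f [b, x', y', z']) (f [a, x', y', z']) (f [a, x, y, z])) \<in> \<alpha> (Suc j)"
      using chain j(1) f subsetD[OF j(2) ab] A unfolding central_def by simp
    ultimately show "(f [b, x, y, z], m (f [b, x', y', z']) (f [a, x', y', z']) (f [a, x, y, z])) \<in> \<delta>0"
      unfolding \<delta>0_def by simp
  qed
  let ?D = "{\<delta>. cong_m \<delta> \<and> \<delta>0 \<subseteq> \<delta> \<and> \<delta> \<subset> \<theta>}"
  have "finite ?D" using fin \<theta>A
    by (intro finite_subset[of ?D "Pow (A \<times> A)"]) auto
  moreover have "\<delta>0 \<in> ?D" using c0 j unfolding \<delta>0_def by auto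
  ultimately have "\<exists>\<delta>\<in>?D. \<delta>0 \<subseteq> \<delta> \<and> (\<forall>\<delta>'\<in>?D. \<delta> \<subseteq> \<delta>' \<longrightarrow> \<delta> = \<delta>')"
    by (rule finite_has_maximal2)
  then obtain \<delta> where \<delta>1: "\<delta> \<in> ?D" and max: "\<forall>\<delta>'\<in>?D. \<delta> \<subseteq> \<delta>' \<longrightarrow> \<delta> = \<delta>'"
    by (elim bexE conjE) (rule that)
  have \<delta>2: "\<delta>' = \<delta>" if "\<delta>' \<in> ?D" "\<delta> \<subseteq> \<delta>'" for \<delta>'
    using bspec[OF max that(1)] that(2) by (rule sym[OF mp])
  note \<delta> = \<delta>1 \<delta>2
  show ?thesis
  proof (rule that[of \<delta>])
    show "cong_m \<delta>" "\<delta> \<subset> \<theta>" using \<delta>(1) by auto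
    show "central \<theta> \<delta>" using \<open>central \<theta> \<delta>0\<close> \<delta>(1) by (simp add: central_mono[of \<theta> \<delta>0 \<delta>])
    show "\<delta>' = \<delta> \<or> \<delta>' = \<theta>" if "cong_m \<delta>'" "\<delta> \<subseteq> \<delta>'" "\<delta>' \<subseteq> \<theta>" for \<delta>'
    proof (cases "\<delta>' = \<theta>")
      case False
      then have "\<delta>' \<in> ?D" using \<delta>(1) that subset_trans[of \<delta>0 \<delta> \<delta>'] by (simp add: psubset_eq)
      with \<delta>(2) that(2) show ?thesis by simp
    qed simp
  qed
qed

end

section \<open>Coordinates of prime order\<close>

text \<open>
  Here \<open>\<theta>\<close> covers \<open>\<delta>\<close> among the congruences of \<open>m\<close> and is central modulo \<open>\<delta>\<close>. A pair of elements
  \<open>u\<close>, \<open>g\<close> that \<open>\<delta>\<close> separates within a class of \<open>\<theta>\<close> yields the translation \<open>tau\<close> with \<open>tau u = g\<close>. Its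
  orbits turn out to be the classes of \<open>\<theta>\<close>, and its order modulo \<open>\<delta>\<close> a prime.
\<close>

locale minimal_central_pair = malcev +
  fixes \<theta> \<delta> :: "'a rel" and u g :: 'a
  assumes fin: "finite A"
    and \<theta>: "cong_m \<theta>" and \<delta>: "cong_m \<delta>" and sub: "\<delta> \<subset> \<theta>"
    and cen: "central \<theta> \<delta>"
    and minimal: "\<And>\<delta>'. cong_m \<delta>' \<Longrightarrow> \<delta> \<subseteq> \<delta>' \<Longrightarrow> \<delta>' \<subseteq> \<theta> \<Longrightarrow> \<delta>' = \<delta> \<or> \<delta>' = \<theta>"
    and ug: "(u, g) \<in> \<theta>" "(u, g) \<notin> \<delta>"
begin

lemma u_in [simp]: "u \<in> A" and g_in [simp]: "g \<in> A"
  using ug cong_m_in[OF \<theta>] by auto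

definition eqd (infix "\<approx>" 50) where "x \<approx> y \<longleftrightarrow> (x, y) \<in> \<delta>"

lemma eqd_trans [trans]: "x \<approx> y \<Longrightarrow> y \<approx> z \<Longrightarrow> x \<approx> z"
  unfolding eqd_def by (rule cong_m_trans[OF \<delta>])

lemma eq_eqd_trans [trans]: "x = y \<Longrightarrow> y \<approx> z \<Longrightarrow> x \<approx> z"
  by simp

lemma eqd_eq_trans [trans]: "x \<approx> y \<Longrightarrow> y = z \<Longrightarrow> x \<approx> z"
  by simp

lemma eqd_sym: "x \<approx> y \<Longrightarrow> y \<approx> x"
  unfolding eqd_def by (rule cong_m_sym[OF \<delta>])

lemma eqd_refl [simp]: "x \<in> A \<Longrightarrow> x \<approx> x"
  unfolding eqd_def by (rule cong_m_refl[OF \<delta>])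

lemma eqd_m: "x \<approx> x' \<Longrightarrow> y \<approx> y' \<Longrightarrow> z \<approx> z' \<Longrightarrow> m x y z \<approx> m x' y' z'"
  unfolding eqd_def by (rule cong_m_m[OF \<delta>])

lemma eqd_in: "x \<approx> y \<Longrightarrow> x \<in> A \<and> y \<in> A"
  unfolding eqd_def by (rule cong_m_in[OF \<delta>])

lemma not_ug: "\<not> u \<approx> g"
  using ug(2) by (simp add: eqd_def)

definition tau :: "'a \<Rightarrow> 'a" where "tau x = m g u x"

abbreviation pow :: "nat \<Rightarrow> 'a \<Rightarrow> 'a" where "pow k \<equiv> tau ^^ k"

lemma tau_in [simp]: "x \<in> A \<Longrightarrow> tau x \<in> A"
  by (simp add: tau_def)

lemma pow_in [simp]: "x \<in> A \<Longrightarrow> pow k x \<in> A"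
  by (induction k) simp_all

lemma tau_u: "tau u = g" by (simp add: tau_def)

lemma pow_add: "pow (k + l) x = pow k (pow l x)"
  by (simp add: funpow_add)

lemma tau_cong: "x \<approx> y \<Longrightarrow> tau x \<approx> tau y"
  unfolding tau_def by (intro eqd_m) simp_all

lemma pow_cong: "x \<approx> y \<Longrightarrow> pow k x \<approx> pow k y"
  by (induction k) (simp_all add: tau_cong)

text \<open>
  Centrality compares \<open>f\<close> at arbitrary arguments with \<open>f\<close> at the base point \<open>u\<close>, where the first argument
  \<open>g\<close> in place of \<open>u\<close> changes the value from \<open>u\<close> to \<open>g\<close>. Hence it acts as \<open>tau\<close> everywhere. The same
  reason gives the third argument.
\<close>

lemma tau_first:
  assumes "x \<in> A" "y \<in> A" "z \<in> A"
  shows "m (tau x) y z \<approx> tau (m x y z)"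
proof -
  have "pol 4 (\<lambda>xs. m (m (xs ! 0) u (xs ! 1)) (xs ! 2) (xs ! 3))"
    by (intro pol_m pol_proj pol_const) simp_all
  from cen[unfolded central_def, rule_format, OF this ug(1), of x y z u u u] assms
  show ?thesis by (simp add: tau_def eqd_def)
qed

lemma tau_third:
  assumes "x \<in> A" "y \<in> A" "z \<in> A"
  shows "m x y (tau z) \<approx> tau (m x y z)"
proof -
  have "pol 4 (\<lambda>xs. m (xs ! 1) (xs ! 2) (m (xs ! 0) u (xs ! 3)))"
    by (intro pol_m pol_proj pol_const) simp_all
  from cen[unfolded central_def, rule_format, OF this ug(1), of x y z u u u] assms
  show ?thesis by (simp add: tau_def eqd_def)
qed

text \<open>
  In the second argument the translation acts with the opposite sign. The comparison is made at
  \<open>(g, u, u)\<close>, where \<open>tau (m g (tau u) u) = g = m g u u\<close>.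
\<close>

lemma tau_second:
  assumes "x \<in> A" "y \<in> A" "z \<in> A"
  shows "tau (m x (tau y) z) \<approx> m x y z"
proof -
  have "pol 4 (\<lambda>xs. m (xs ! 0) u (m (xs ! 1) (m (xs ! 0) u (xs ! 2)) (xs ! 3)))"
    by (intro pol_m pol_proj pol_const) simp_all
  from cen[unfolded central_def, rule_format, OF this ug(1), of x y z g u u] assms
  show ?thesis by (simp add: tau_def eqd_def)
qed

lemma pow_first:
  assumes "x \<in> A" "y \<in> A" "z \<in> A"
  shows "m (pow k x) y z \<approx> pow k (m x y z)"
proof (induction k)
  case (Suc k)
  have "m (pow (Suc k) x) y z \<approx> tau (m (pow k x) y z)"
    using assms by (simp add: tau_first)
  also have "\<dots> \<approx> pow (Suc k) (m x y z)" using tau_cong[OF Suc] by simp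
  finally show ?case .
qed (use assms in simp)

lemma pow_third:
  assumes "x \<in> A" "y \<in> A" "z \<in> A"
  shows "m x y (pow k z) \<approx> pow k (m x y z)"
proof (induction k)
  case (Suc k)
  have "m x y (pow (Suc k) z) \<approx> tau (m x y (pow k z))"
    using assms by (simp add: tau_third)
  also have "\<dots> \<approx> pow (Suc k) (m x y z)" using tau_cong[OF Suc] by simp
  finally show ?case .
qed (use assms in simp)

lemma pow_second:
  assumes "x \<in> A" "y \<in> A" "z \<in> A"
  shows "pow k (m x (pow k y) z) \<approx> m x y z"
proof (induction k)
  case (Suc k)
  have "pow (Suc k) (m x (pow (Suc k) y) z) = pow k (tau (m x (tau (pow k y)) z))"
    by (simp add: funpow_swap1)
  also have "\<dots> \<approx> pow k (m x (pow k y) z)"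
    using assms by (intro pow_cong tau_second) simp_all
  also note Suc
  finally show ?case .
qed (use assms in simp)

lemma tau_cancel:
  assumes "x \<in> A" "y \<in> A" "tau x \<approx> tau y"
  shows "x \<approx> y"
proof -
  have inverse: "m u (tau u) (tau z) \<approx> z" if "z \<in> A" for z
  proof -
    have "m u (tau u) (tau z) \<approx> tau (m u (tau u) z)"
      using that by (intro tau_third) simp_all
    also have "\<dots> \<approx> m u u z" using that by (intro tau_second) simp_all
    finally show ?thesis using that by simp
  qed
  have "x \<approx> m u (tau u) (tau x)" by (rule eqd_sym[OF inverse[OF assms(1)]])
  also have "\<dots> \<approx> m u (tau u) (tau y)" using assms by (intro eqd_m) simp_all
  also have "\<dots> \<approx> y" by (rule inverse[OF assms(2)])
  finally show ?thesis .
qed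

lemma pow_cancel: "x \<in> A \<Longrightarrow> y \<in> A \<Longrightarrow> pow k x \<approx> pow k y \<Longrightarrow> x \<approx> y"
  by (induction k) (auto dest: tau_cancel[rotated 2])

text \<open>
  Equal up to translation: the exponents behave additively, with a minus sign for the second argument.
  Subtraction is avoided by moving exponents to the other side.
\<close>

lemma pow_m:
  assumes in_A: "x \<in> A" "x' \<in> A" "y \<in> A" "y' \<in> A" "z \<in> A" "z' \<in> A"
    and x: "pow k1 x \<approx> pow l1 x'" and y: "pow k2 y \<approx> pow l2 y'" and z: "pow k3 z \<approx> pow l3 z'"
  shows "pow (k1 + l2 + k3) (m x y z) \<approx> pow (l1 + k2 + l3) (m x' y' z')"
proof -
  have 1: "pow k1 (m x y z) \<approx> pow l1 (m x' y z)"
  proof -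
    have "pow k1 (m x y z) \<approx> m (pow k1 x) y z"
      by (rule eqd_sym[OF pow_first]) (use in_A in simp_all)
    also have "\<dots> \<approx> m (pow l1 x') y z" using in_A x by (intro eqd_m) simp_all
    also have "\<dots> \<approx> pow l1 (m x' y z)" by (rule pow_first) (use in_A in simp_all)
    finally show ?thesis .
  qed
  have 2: "pow l2 (m x' y z) \<approx> pow k2 (m x' y' z)"
  proof -
    have "pow l2 (m x' y z) \<approx> pow l2 (pow k2 (m x' (pow k2 y) z))"
      using in_A by (intro pow_cong eqd_sym[OF pow_second]) simp_all
    also have "\<dots> \<approx> pow l2 (pow k2 (m x' (pow l2 y') z))"
      using in_A y by (intro pow_cong eqd_m) simp_all
    also have "\<dots> = pow k2 (pow l2 (m x' (pow l2 y') z))"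
      by (simp add: pow_add[symmetric] add.commute)
    also have "\<dots> \<approx> pow k2 (m x' y' z)"
      using in_A by (intro pow_cong pow_second) simp_all
    finally show ?thesis .
  qed
  have 3: "pow k3 (m x' y' z) \<approx> pow l3 (m x' y' z')"
  proof -
    have "pow k3 (m x' y' z) \<approx> m x' y' (pow k3 z)"
      by (rule eqd_sym[OF pow_third]) (use in_A in simp_all)
    also have "\<dots> \<approx> m x' y' (pow l3 z')" using in_A z by (intro eqd_m) simp_all
    also have "\<dots> \<approx> pow l3 (m x' y' z')" by (rule pow_third) (use in_A in simp_all)
    finally show ?thesis .
  qed
  have "pow (k1 + l2 + k3) (m x y z) = pow (l2 + k3) (pow k1 (m x y z))"
    by (simp add: pow_add[symmetric] ac_simps)
  also have "\<dots> \<approx> pow (l2 + k3) (pow l1 (m x' y z))" by (rule pow_cong[OF 1])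
  also have "\<dots> = pow (l1 + k3) (pow l2 (m x' y z))"
    by (simp add: pow_add[symmetric] ac_simps)
  also have "\<dots> \<approx> pow (l1 + k3) (pow k2 (m x' y' z))" by (rule pow_cong[OF 2])
  also have "\<dots> = pow (l1 + k2) (pow k3 (m x' y' z))"
    by (simp add: pow_add[symmetric] ac_simps)
  also have "\<dots> \<approx> pow (l1 + k2) (pow l3 (m x' y' z'))" by (rule pow_cong[OF 3])
  also have "\<dots> = pow (l1 + k2 + l3) (m x' y' z')"
    by (simp add: pow_add[symmetric] ac_simps)
  finally show ?thesis .
qed

text \<open>
  Using exponents on both sides makes symmetry evident, without knowing that \<open>tau\<close> has finite order.
\<close>

definition orbit :: "nat \<Rightarrow> 'a rel" where
  "orbit a = {(x, y). x \<in> A \<and> y \<in> A \<and> (\<exists>k l. pow (a * k) x \<approx> pow (a * l) y)}"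

lemma cong_m_orbit: "cong_m (orbit a)"
proof (rule cong_mI)
  fix x y assume "(x, y) \<in> orbit a"
  then show "x \<in> A \<and> y \<in> A" "(y, x) \<in> orbit a" unfolding orbit_def using eqd_sym by blast+
next
  fix x assume "x \<in> A"
  then show "(x, x) \<in> orbit a" unfolding orbit_def using eqd_refl pow_in by blast
next
  fix x y z assume xy: "(x, y) \<in> orbit a" and yz: "(y, z) \<in> orbit a"
  from xy obtain k l where 1: "x \<in> A" "pow (a * k) x \<approx> pow (a * l) y"
    unfolding orbit_def by blast
  from yz obtain k' l' where 2: "z \<in> A" "pow (a * k') y \<approx> pow (a * l') z"
    unfolding orbit_def by blast
  have "pow (a * (k + k')) x = pow (a * k') (pow (a * k) x)"
    by (simp add: pow_add[symmetric] algebra_simps)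
  also have "\<dots> \<approx> pow (a * k') (pow (a * l) y)" by (rule pow_cong[OF 1(2)])
  also have "\<dots> = pow (a * l) (pow (a * k') y)"
    by (simp add: pow_add[symmetric] algebra_simps)
  also have "\<dots> \<approx> pow (a * l) (pow (a * l') z)" by (rule pow_cong[OF 2(2)])
  also have "\<dots> = pow (a * (l + l')) z"
    by (simp add: pow_add[symmetric] algebra_simps)
  finally show "(x, z) \<in> orbit a" using 1(1) 2(1) unfolding orbit_def by blast
next
  fix x x' y y' z z'
  assume xx: "(x, x') \<in> orbit a" and yy: "(y, y') \<in> orbit a" and zz: "(z, z') \<in> orbit a"
  from xx obtain k1 l1 where 1: "x \<in> A" "x' \<in> A" "pow (a * k1) x \<approx> pow (a * l1) x'"
    unfolding orbit_def by blast
  from yy obtain k2 l2 where 2: "y \<in> A" "y' \<in> A" "pow (a * k2) y \<approx> pow (a * l2) y'"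
    unfolding orbit_def by blast
  from zz obtain k3 l3 where 3: "z \<in> A" "z' \<in> A" "pow (a * k3) z \<approx> pow (a * l3) z'"
    unfolding orbit_def by blast
  have "pow (a * (k1 + l2 + k3)) (m x y z) \<approx> pow (a * (l1 + k2 + l3)) (m x' y' z')"
    using pow_m[OF 1(1,2) 2(1,2) 3(1,2) 1(3) 2(3) 3(3)] by (simp add: algebra_simps)
  with 1 2 3 show "(m x y z, m x' y' z') \<in> orbit a" unfolding orbit_def by blast
qed

lemma pow_theta: "x \<in> A \<Longrightarrow> (x, pow k x) \<in> \<theta>"
proof (induction k)
  case (Suc k)
  have "(m u u (pow k x), m g u (pow k x)) \<in> \<theta>"
    using Suc.prems ug(1) by (intro cong_m_m[OF \<theta>] cong_m_refl[OF \<theta>]) simp_all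
  then have "(pow k x, pow (Suc k) x) \<in> \<theta>"
    using Suc.prems unfolding funpow.simps comp_def tau_def[of "pow k x"] by simp
  with Suc show ?case by (blast intro: cong_m_trans[OF \<theta>, of x "pow k x"])
qed (simp add: cong_m_refl[OF \<theta>])

lemma orbit_cases: "orbit a = \<delta> \<or> orbit a = \<theta>"
proof (rule minimal[OF cong_m_orbit])
  show "\<delta> \<subseteq> orbit a"
  proof (rule subrelI)
    fix x y assume "(x, y) \<in> \<delta>"
    then have "x \<in> A" "y \<in> A" "pow (a * 0) x \<approx> pow (a * 0) y" using eqd_in
      by (auto simp: eqd_def[symmetric])
    then show "(x, y) \<in> orbit a" unfolding orbit_def by blast
  qed
  show "orbit a \<subseteq> \<theta>"
  proof (rule subrelI)
    fix x y assume "(x, y) \<in> orbit a"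
    then obtain k l where xy: "x \<in> A" "y \<in> A" "pow (a * k) x \<approx> pow (a * l) y"
      unfolding orbit_def by blast
    have "(pow (a * k) x, pow (a * l) y) \<in> \<theta>" using xy(3) sub unfolding eqd_def by blast
    from cong_m_trans[OF \<theta> pow_theta[OF xy(1)] this] cong_m_sym[OF \<theta> pow_theta[OF xy(2)]]
    show "(x, y) \<in> \<theta>" by (rule cong_m_trans[OF \<theta>])
  qed
qed

lemma orbit_1: "orbit 1 = \<theta>"
proof -
  have "pow (1 * 1) u \<approx> pow (1 * 0) g" by (simp add: tau_u)
  then have "(u, g) \<in> orbit 1" unfolding orbit_def using u_in g_in by blast
  with ug(2) orbit_cases[of 1] show ?thesis by auto
qed

lemma period_iff: "x \<in> A \<Longrightarrow> pow k x \<approx> x \<longleftrightarrow> pow k u \<approx> u"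
proof
  assume x: "x \<in> A" "pow k x \<approx> x"
  have "pow k (m x x u) \<approx> m (pow k x) x u" by (rule eqd_sym[OF pow_first]) (use x in simp_all)
  also have "\<dots> \<approx> m x x u" using x by (intro eqd_m) simp_all
  finally show "pow k u \<approx> u" using x by simp
next
  assume x: "x \<in> A" and k: "pow k u \<approx> u"
  have "pow k (m u u x) \<approx> m (pow k u) u x" by (rule eqd_sym[OF pow_first]) (use x in simp_all)
  also have "\<dots> \<approx> m u u x" using x k by (intro eqd_m) simp_all
  finally show "pow k x \<approx> x" using x by simp
qed

definition period :: nat where "period = (LEAST k. 0 < k \<and> pow k u \<approx> u)"

lemma period: "0 < period" "pow period u \<approx> u"
proof -
  have "\<not> inj (\<lambda>k. pow k u)"
  proof
    assume "inj (\<lambda>k. pow k u)"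
    then have "infinite (range (\<lambda>k. pow k u))" using finite_imageD infinite_UNIV_nat by blast
    moreover have "range (\<lambda>k. pow k u) \<subseteq> A" by auto
    ultimately show False using fin finite_subset by blast
  qed
  then obtain k l where kl: "k < l" "pow k u = pow l u"
    unfolding inj_def by (metis linorder_neqE_nat)
  then have "pow k u \<approx> pow k (pow (l - k) u)" by (simp add: pow_add[symmetric])
  then have "u \<approx> pow (l - k) u" by (rule pow_cancel[rotated 2]) simp_all
  then have "0 < l - k \<and> pow (l - k) u \<approx> u" using kl(1) eqd_sym by simp
  then have "0 < period \<and> pow period u \<approx> u" unfolding period_def by (rule LeastI)
  then show "0 < period" "pow period u \<approx> u" by auto
qed

lemma period_multiple: "pow (period * k) u \<approx> u"
proof (induction k)
  case (Suc k)
  have "pow (period * Suc k) u = pow period (pow (period * k) u)"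
    by (simp add: pow_add[symmetric])
  also have "\<dots> \<approx> pow period u" by (rule pow_cong[OF Suc])
  also note period(2)
  finally show ?case .
qed simp

lemma period_dvd: "pow k u \<approx> u \<longleftrightarrow> period dvd k"
proof
  assume k: "pow k u \<approx> u"
  have "pow (k mod period) u \<approx> pow (k mod period) (pow (period * (k div period)) u)"
    by (rule pow_cong[OF eqd_sym[OF period_multiple]])
  also have "\<dots> = pow k u" by (simp add: pow_add[symmetric])
  also note k
  finally have "\<not> 0 < k mod period"
    using not_less_Least[of "k mod period" "\<lambda>k. 0 < k \<and> pow k u \<approx> u"] period(1)
    unfolding period_def[symmetric] by simp
  then show "period dvd k" by (simp add: dvd_eq_mod_eq_0)
qed (use period_multiple in auto)

lemma pow_eq_iff:
  assumes "x \<in> A"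
  shows "pow k x \<approx> pow l x \<longleftrightarrow> [k = l] (mod period)"
proof -
  have le: "pow k x \<approx> pow l x \<longleftrightarrow> [k = l] (mod period)" if "k \<le> l" for k l
  proof -
    have "pow l x = pow k (pow (l - k) x)" using that by (simp add: pow_add[symmetric])
    then have "pow k x \<approx> pow l x \<longleftrightarrow> x \<approx> pow (l - k) x"
      using assms pow_cong[of x "pow (l - k) x" k] pow_cancel[of x "pow (l - k) x" k] by auto
    also have "\<dots> \<longleftrightarrow> pow (l - k) x \<approx> x" by (rule iffI) (rule eqd_sym, assumption)+
    also have "\<dots> \<longleftrightarrow> period dvd l - k" using assms by (simp add: period_iff period_dvd)
    also have "\<dots> \<longleftrightarrow> [k = l] (mod period)"
      using that by (metis cong_altdef_nat cong_sym)
    finally show ?thesis .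
  qed
  show ?thesis
  proof (cases "k \<le> l")
    case False
    then show ?thesis using le[of l k] eqd_sym[of "pow k x" "pow l x"] eqd_sym[of "pow l x" "pow k x"]
      by (auto intro: cong_sym)
  qed (rule le)
qed

text \<open>
  For a proper divisor \<open>a\<close> of the period, the relation \<open>orbit a\<close> would be a congruence strictly between
  \<open>\<delta>\<close> and \<open>\<theta>\<close>.
\<close>

lemma prime_period: "prime period"
proof (rule ccontr)
  assume not_prime: "\<not> prime period"
  have "period \<noteq> 1" using period(2) not_ug eqd_sym by (auto simp: tau_u)
  with not_prime period(1) obtain a where a: "a dvd period" "a \<noteq> 1" "a \<noteq> period"
    using prime_nat_iff[of period] by auto
  have "pow (a * 1) u \<approx> pow (a * 0) (pow a u)" by simp
  then have "(u, pow a u) \<in> orbit a" unfolding orbit_def using u_in pow_in by blast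
  moreover have "(u, pow a u) \<notin> \<delta>" unfolding eqd_def[symmetric]
    using a period_dvd[of a] eqd_sym by (meson dvd_antisym)
  ultimately have "orbit a = \<theta>" using orbit_cases[of a] by auto
  then have "(u, g) \<in> orbit a" using ug(1) by simp
  then obtain k l where "pow (a * k) u \<approx> pow (a * l) (tau u)"
    unfolding orbit_def tau_u by blast
  then have "pow (a * k) u \<approx> pow (a * l + 1) u" by (simp add: funpow_swap1)
  then have "[a * k = a * l + 1] (mod period)" using pow_eq_iff[OF u_in] by blast
  then have "[a * k = a * l + 1] (mod a)" using a(1) by (rule cong_dvd_modulus_nat)
  then have "a dvd a * k \<longleftrightarrow> a dvd a * l + 1" by (rule cong_dvd_iff)
  then have "a dvd 1" by (simp only: dvd_triv_left dvd_add_right_iff simp_thms)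
  with a(2) show False by simp
qed

definition rep :: "'a \<Rightarrow> 'a" where "rep x = (SOME y. (x, y) \<in> \<theta>)"

text \<open>
  The exponent of \<open>tau\<close> that leads from a representative of the \<open>\<theta>\<close>-class of \<open>x\<close> to \<open>x\<close>.
\<close>

definition expo :: "'a \<Rightarrow> nat" where "expo x = (SOME k. pow k (rep x) \<approx> x)"

lemma rep:
  assumes "x \<in> A"
  shows "(x, rep x) \<in> \<theta>"
  unfolding rep_def using cong_m_refl[OF \<theta> assms] by (rule someI)

lemma rep_eq: "(x, y) \<in> \<theta> \<Longrightarrow> rep x = rep y"
  unfolding rep_def by (rule arg_cong[where f = Eps]) (metis cong_m_sym[OF \<theta>] cong_m_trans[OF \<theta>])

lemma expo:
  assumes x: "x \<in> A"
  shows "pow (expo x) (rep x) \<approx> x"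
proof -
  have r: "rep x \<in> A" using rep[OF x] cong_m_in[OF \<theta>] by blast
  have "(rep x, x) \<in> orbit 1" using cong_m_sym[OF \<theta> rep[OF x]] by (simp only: orbit_1)
  then obtain k l where kl: "pow k (rep x) \<approx> pow l x" unfolding orbit_def by auto
  have "l \<le> period * l" using period(1) by simp
  have "pow (period * l - l + k) (rep x) = pow (period * l - l) (pow k (rep x))"
    by (rule pow_add)
  also have "\<dots> \<approx> pow (period * l - l) (pow l x)" by (rule pow_cong[OF kl])
  also have "\<dots> = pow (period * l) x"
    by (simp only: pow_add[symmetric] le_add_diff_inverse2[OF \<open>l \<le> period * l\<close>])
  also have "\<dots> \<approx> x" using x by (simp add: period_iff period_multiple)
  finally show ?thesis unfolding expo_def by (rule someI)
qed

lemma expo_swap: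
  assumes "(x, x') \<in> \<theta>"
  shows "pow (expo x') x \<approx> pow (expo x) x'"
proof -
  have A: "x \<in> A" "x' \<in> A" using assms cong_m_in[OF \<theta>] by blast+
  have "pow (expo x') x \<approx> pow (expo x') (pow (expo x) (rep x))"
    by (rule pow_cong[OF eqd_sym[OF expo[OF A(1)]]])
  also have "\<dots> = pow (expo x) (pow (expo x') (rep x'))"
    by (simp add: pow_add[symmetric] add.commute rep_eq[OF assms])
  also have "\<dots> \<approx> pow (expo x) x'" by (rule pow_cong[OF expo[OF A(2)]])
  finally show ?thesis .
qed

lemma expo_eq_iff:
  assumes "(x, x') \<in> \<theta>"
  shows "[expo x = expo x'] (mod period) \<longleftrightarrow> x \<approx> x'"
proof -
  have A: "x \<in> A" "x' \<in> A" using assms cong_m_in[OF \<theta>] by blast+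
  have r: "rep x \<in> A" using rep[OF A(1)] cong_m_in[OF \<theta>] by blast
  have "[expo x = expo x'] (mod period) \<longleftrightarrow> pow (expo x) (rep x) \<approx> pow (expo x') (rep x')"
    using pow_eq_iff[OF r] rep_eq[OF assms] by simp
  also have "\<dots> \<longleftrightarrow> x \<approx> x'"
    using eqd_trans[OF eqd_trans[OF eqd_sym[OF expo[OF A(1)]]] expo[OF A(2)]]
      eqd_trans[OF eqd_trans[OF expo[OF A(1)]] eqd_sym[OF expo[OF A(2)]]] by (rule iffI)
  finally show ?thesis .
qed

text \<open>
  Comparing \<open>pow_m\<close> with \<open>expo_swap\<close> for \<open>m x y z\<close> and \<open>m x' y' z'\<close> gives
  \<open>m x' y' z' - m x y z = (x' - x) - (y' - y) + (z' - z)\<close> for exponents. Negative terms are moved to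
  the other side.
\<close>

lemma expo_m:
  assumes "(x, x') \<in> \<theta>" "(y, y') \<in> \<theta>" "(z, z') \<in> \<theta>"
  shows "[expo (m x' y' z') + (expo x + expo y' + expo z) = expo (m x y z)
    + (expo x' + expo y + expo z')] (mod period)"
proof -
  have A: "x \<in> A" "x' \<in> A" "y \<in> A" "y' \<in> A" "z \<in> A" "z' \<in> A"
    using assms cong_m_in[OF \<theta>] by blast+
  let ?w = "m x y z" and ?w' = "m x' y' z'"
  have "(?w, ?w') \<in> \<theta>" using assms by (intro cong_m_m[OF \<theta>])
  from expo_swap[OF this] have 1: "pow (expo ?w') ?w \<approx> pow (expo ?w) ?w'" .
  have 2: "pow (expo x' + expo y + expo z') ?w \<approx> pow (expo x + expo y' + expo z) ?w'"
    by (rule pow_m[OF A expo_swap[OF assms(1)] expo_swap[OF assms(2)] expo_swap[OF assms(3)]])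
  have "pow (expo ?w' + (expo x + expo y' + expo z)) ?w
    = pow (expo x + expo y' + expo z) (pow (expo ?w') ?w)"
    by (simp add: pow_add[symmetric] add.commute)
  also have "\<dots> \<approx> pow (expo x + expo y' + expo z) (pow (expo ?w) ?w')" by (rule pow_cong[OF 1])
  also have "\<dots> = pow (expo ?w) (pow (expo x + expo y' + expo z) ?w')"
    by (simp add: pow_add[symmetric] add.commute)
  also have "\<dots> \<approx> pow (expo ?w) (pow (expo x' + expo y + expo z') ?w)"
    by (rule pow_cong[OF eqd_sym[OF 2]])
  also have "\<dots> = pow (expo ?w + (expo x' + expo y + expo z')) ?w"
    by (simp add: pow_add[symmetric])
  finally show ?thesis using pow_eq_iff[of ?w] A by simp
qed

end

context malcev
begin

text \<open>
  On classes of \<open>E\<close>, and modulo \<open>p\<close>, the function \<open>\<phi>\<close> carries \<open>m\<close> to \<open>x - y + z\<close> up to a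
  constant that depends on the classes of the three arguments.
\<close>

definition affine_on :: "'a rel \<Rightarrow> nat \<Rightarrow> ('a \<Rightarrow> int) \<Rightarrow> bool" where
  "affine_on E p \<phi> \<longleftrightarrow> (\<forall>x x' y y' z z'. (x, x') \<in> E \<longrightarrow> (y, y') \<in> E \<longrightarrow> (z, z') \<in> E \<longrightarrow>
     [\<phi> (m x' y' z') - \<phi> (m x y z) = (\<phi> x' - \<phi> x) - (\<phi> y' - \<phi> y) + (\<phi> z' - \<phi> z)] (mod int p))"

definition same_coords :: "(nat \<times> ('a \<Rightarrow> int)) set \<Rightarrow> 'a rel" where
  "same_coords C = {(x, y). \<forall>(p, \<phi>)\<in>C. [\<phi> x = \<phi> y] (mod int p)}"

lemma exists_prime_coordinate:
  assumes fin: "finite A"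
    and chain: "central_chain k \<alpha>"
    and \<theta>: "cong_m \<theta>" "\<theta> \<noteq> Id_on A"
  obtains p \<phi> where "prime p" "affine_on \<theta> p \<phi>"
    "cong_m (\<theta> \<inter> same_coords {(p, \<phi>)})" "\<theta> \<inter> same_coords {(p, \<phi>)} \<subset> \<theta>"
proof -
  obtain \<delta> where d: "cong_m \<delta>" "\<delta> \<subset> \<theta>" "central \<theta> \<delta>"
    "\<And>\<delta>'. cong_m \<delta>' \<Longrightarrow> \<delta> \<subseteq> \<delta>' \<Longrightarrow> \<delta>' \<subseteq> \<theta> \<Longrightarrow> \<delta>' = \<delta> \<or> \<delta>' = \<theta>"
    using exists_maximal_central[OF fin chain \<theta>] by metis
  then obtain u g where ug: "(u, g) \<in> \<theta>" "(u, g) \<notin> \<delta>" by auto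
  interpret minimal_central_pair A m \<theta> \<delta> u g
    by unfold_locales (fact fin \<theta>(1) d ug)+
  let ?\<phi> = "\<lambda>x. int (expo x)"
  have "\<theta> \<inter> same_coords {(period, ?\<phi>)} = \<delta>"
  proof (intro subset_antisym subrelI)
    fix x y assume "(x, y) \<in> \<theta> \<inter> same_coords {(period, ?\<phi>)}"
    then show "(x, y) \<in> \<delta>"
      using expo_eq_iff[of x y] by (simp add: same_coords_def cong_int_iff eqd_def)
  next
    fix x y assume xy: "(x, y) \<in> \<delta>"
    then have "(x, y) \<in> \<theta>" using d(2) by blast
    with xy show "(x, y) \<in> \<theta> \<inter> same_coords {(period, ?\<phi>)}"
      using expo_eq_iff[of x y] by (simp add: same_coords_def cong_int_iff eqd_def)
  qed
  moreover have "affine_on \<theta> period ?\<phi>"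
    unfolding affine_on_def
  proof (intro allI impI)
    fix x x' y y' z z' assume *: "(x, x') \<in> \<theta>" "(y, y') \<in> \<theta>" "(z, z') \<in> \<theta>"
    have "[int (expo (m x' y' z') + (expo x + expo y' + expo z))
        = int (expo (m x y z) + (expo x' + expo y + expo z'))] (mod int period)"
      using expo_m[OF *] by (simp only: cong_int_iff)
    from cong_diff[OF this cong_refl[of "int (expo x + expo y' + expo z + expo (m x y z))"]]
    show "[?\<phi> (m x' y' z') - ?\<phi> (m x y z) = (?\<phi> x' - ?\<phi> x) - (?\<phi> y' - ?\<phi> y)
      + (?\<phi> z' - ?\<phi> z)] (mod int period)"
      by (simp add: algebra_simps)
  qed
  ultimately show ?thesis
    using that[OF prime_period] d(1,2) by simp
qed

text \<open>
  Each coordinate cuts the classes of \<open>\<theta>\<close> down to those of a smaller congruence, until equality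
  remains.
\<close>

lemma exists_coordinates:
  assumes fin: "finite A"
    and chain: "central_chain k \<alpha>"
    and "cong_m \<theta>"
  shows "\<exists>cs. (\<forall>i<length cs. prime (fst (cs ! i)) \<and>
      affine_on (\<theta> \<inter> same_coords (set (take i cs))) (fst (cs ! i)) (snd (cs ! i))) \<and>
    \<theta> \<inter> same_coords (set cs) \<subseteq> Id"
  using \<open>cong_m \<theta>\<close>
proof (induction "card \<theta>" arbitrary: \<theta> rule: less_induct)
  case less
  show ?case
  proof (cases "\<theta> = Id_on A")
    case True
    then show ?thesis by (intro exI[of _ "[]"]) auto
  next
    case False
    obtain p \<phi> where p: "prime p" "affine_on \<theta> p \<phi>"
      "cong_m (\<theta> \<inter> same_coords {(p, \<phi>)})" "\<theta> \<inter> same_coords {(p, \<phi>)} \<subset> \<theta>"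
      using exists_prime_coordinate[OF fin chain less.prems False] by metis
    have "\<theta> \<subseteq> A \<times> A" using cong_m_in[OF less.prems] by auto
    then have "finite \<theta>" using fin finite_subset by blast
    from psubset_card_mono[OF this p(4)] less.hyps[OF _ p(3)]
    obtain cs where cs: "\<forall>i<length cs. prime (fst (cs ! i)) \<and>
        affine_on (\<theta> \<inter> same_coords {(p, \<phi>)} \<inter> same_coords (set (take i cs))) (fst (cs ! i)) (snd (cs ! i))"
      "\<theta> \<inter> same_coords {(p, \<phi>)} \<inter> same_coords (set cs) \<subseteq> Id"
      by auto
    have ins: "same_coords (insert (p, \<phi>) C) = same_coords {(p, \<phi>)} \<inter> same_coords C" for C
      by (auto simp: same_coords_def)
    have empty: "same_coords {} = UNIV" by (simp add: same_coords_def)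
    have "prime (fst (((p, \<phi>) # cs) ! i)) \<and>
        affine_on (\<theta> \<inter> same_coords (set (take i ((p, \<phi>) # cs))))
          (fst (((p, \<phi>) # cs) ! i)) (snd (((p, \<phi>) # cs) ! i))" if "i < length ((p, \<phi>) # cs)" for i
    proof (cases i)
      case 0
      then show ?thesis using p(1,2) by (simp add: empty)
    next
      case (Suc j)
      then have "j < length cs" using that by simp
      with cs(1) Suc show ?thesis
        unfolding Suc take_Suc_Cons list.set nth_Cons_Suc ins[of "set (take j cs)"] Int_assoc[symmetric]
        by blast
    qed
    then have "\<forall>i<length ((p, \<phi>) # cs). prime (fst (((p, \<phi>) # cs) ! i)) \<and>
        affine_on (\<theta> \<inter> same_coords (set (take i ((p, \<phi>) # cs))))
          (fst (((p, \<phi>) # cs) ! i)) (snd (((p, \<phi>) # cs) ! i))"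
      by (intro allI impI)
    moreover have "\<theta> \<inter> same_coords (set ((p, \<phi>) # cs)) \<subseteq> Id"
      using cs(2) unfolding list.set ins[of "set cs"] Int_assoc .
    ultimately show ?thesis by (rule_tac x = "(p, \<phi>) # cs" in exI) (rule conjI)
  qed
qed

end

section \<open>Separating the primes\<close>

text \<open>
  Two powers \<open>f ^^ i\<close> and \<open>f ^^ (i + d)\<close> agree on the finite set, so the powers from \<open>i\<close> on are periodic
  with period \<open>d\<close>. Any multiple of \<open>d\<close> that is at least \<open>i\<close> will do.
\<close>

lemma idempotent_power:
  assumes fin: "finite A" and f: "f \<in> A \<rightarrow> A"
  obtains k where "1 \<le> k" "\<forall>x\<in>A. (f ^^ k) ((f ^^ k) x) = (f ^^ k) x"
proof -
  have pow_in: "(f ^^ k) x \<in> A" if "x \<in> A" for k x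
    using that f by (induction k) auto
  have add: "(f ^^ a) ((f ^^ b) x) = (f ^^ (a + b)) x" for a b x
    by (simp add: funpow_add)
  let ?F = "\<lambda>k. \<lambda>x\<in>A. (f ^^ k) x"
  have "\<not> inj ?F"
  proof
    assume "inj ?F"
    then have "infinite (range ?F)" using finite_imageD infinite_UNIV_nat by blast
    moreover have "range ?F \<subseteq> A \<rightarrow>\<^sub>E A" using pow_in by auto
    ultimately show False using finite_PiE[OF fin, of "\<lambda>_. A"] fin finite_subset by blast
  qed
  then obtain i j where ij: "i < j" "?F i = ?F j"
    unfolding inj_def by (metis linorder_neqE_nat)
  define d where "d = j - i"
  have step: "(f ^^ (i + d)) x = (f ^^ i) x" if "x \<in> A" for x
    using fun_cong[OF ij(2), of x] that ij(1) by (simp add: d_def)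
  have steps: "(f ^^ (i + l * d)) x = (f ^^ i) x" if "x \<in> A" for x l
  proof (induction l)
    case (Suc l)
    have "(f ^^ (i + Suc l * d)) x = (f ^^ (l * d)) ((f ^^ (i + d)) x)"
      by (simp add: add ac_simps)
    also have "\<dots> = (f ^^ (i + l * d)) x"
      using step[OF that] add[of "l * d" i x] by (simp add: ac_simps)
    finally show ?case using Suc by simp
  qed simp
  define k where "k = Suc i * d"
  have "0 < d" using ij(1) by (simp add: d_def)
  then have "i \<le> i * d" by simp
  then have "i \<le> k" unfolding k_def mult_Suc by (rule trans_le_add2)
  with \<open>0 < d\<close> have k: "1 \<le> k" "i \<le> k" by (simp_all add: k_def)
  have "(f ^^ k) ((f ^^ k) x) = (f ^^ k) x" if "x \<in> A" for x
  proof -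
    have "(f ^^ k) ((f ^^ k) x) = (f ^^ (k - i)) ((f ^^ (i + Suc i * d)) x)"
      using k(2) by (simp add: add k_def[symmetric] del: mult_Suc)
    also have "\<dots> = (f ^^ (k - i)) ((f ^^ i) x)" by (simp only: steps[OF that])
    also have "\<dots> = (f ^^ k) x" using k(2) by (simp add: add)
    finally show ?thesis .
  qed
  with k(1) show ?thesis by (intro that) auto
qed

lemma diff_cong_0_iff: "[b - a = 0] (mod c) \<longleftrightarrow> [a = b] (mod c)" for a b c :: int
  by (subst cong_diff_iff_cong_0) (rule cong_sym_eq)

locale coordinatized = malcev A m for A :: "'a set" and m +
  fixes n :: nat and p :: "nat \<Rightarrow> nat" and \<phi> :: "nat \<Rightarrow> 'a \<Rightarrow> int" and u :: 'a
  assumes fin: "finite A" and u_in [simp]: "u \<in> A"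
    and prime: "i < n \<Longrightarrow> prime (p i)"
    and affine: "i < n \<Longrightarrow>
      affine_on {(x, y). x \<in> A \<and> y \<in> A \<and> (\<forall>j<i. [\<phi> j x = \<phi> j y] (mod int (p j)))} (p i) (\<phi> i)"
    and separating: "x \<in> A \<Longrightarrow> y \<in> A \<Longrightarrow> (\<And>i. i < n \<Longrightarrow> [\<phi> i x = \<phi> i y] (mod int (p i))) \<Longrightarrow> x = y"
begin

definition agree :: "nat \<Rightarrow> 'a \<Rightarrow> 'a \<Rightarrow> bool" where
  "agree i x y \<longleftrightarrow> (\<forall>j<i. [\<phi> j x = \<phi> j y] (mod int (p j)))"

lemma agree_refl [simp]: "agree i x x"
  by (simp add: agree_def)

lemma agree_sym: "agree i x y \<Longrightarrow> agree i y x"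
  by (simp add: agree_def cong_sym_eq)

lemma agree_trans: "agree i x y \<Longrightarrow> agree i y z \<Longrightarrow> agree i x z"
  unfolding agree_def by (meson cong_trans)

lemma agree_Suc: "agree (Suc i) x y \<longleftrightarrow> agree i x y \<and> [\<phi> i x = \<phi> i y] (mod int (p i))"
  by (auto simp: agree_def less_Suc_eq)

lemma agree_0 [simp]: "agree 0 x y"
  by (simp add: agree_def)

lemma agree_eq: "x \<in> A \<Longrightarrow> y \<in> A \<Longrightarrow> agree n x y \<Longrightarrow> x = y"
  by (rule separating) (simp_all add: agree_def)

lemma affine_m:
  assumes "i < n" "x \<in> A" "x' \<in> A" "y \<in> A" "y' \<in> A" "z \<in> A" "z' \<in> A"
    "agree i x x'" "agree i y y'" "agree i z z'"
  shows "[\<phi> i (m x' y' z') - \<phi> i (m x y z) = (\<phi> i x' - \<phi> i x) - (\<phi> i y' - \<phi> i y)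
    + (\<phi> i z' - \<phi> i z)] (mod int (p i))"
  using affine[OF assms(1)] assms(2-) unfolding affine_on_def agree_def by simp

lemma agree_m:
  assumes A: "x \<in> A" "x' \<in> A" "y \<in> A" "y' \<in> A" "z \<in> A" "z' \<in> A"
    and "i \<le> n" "agree i x x'" "agree i y y'" "agree i z z'"
  shows "agree i (m x y z) (m x' y' z')"
  using assms(7-)
proof (induction i)
  case (Suc i)
  then have c: "[\<phi> i x' - \<phi> i x = 0] (mod int (p i))" "[\<phi> i y' - \<phi> i y = 0] (mod int (p i))"
    "[\<phi> i z' - \<phi> i z = 0] (mod int (p i))"
    by (simp_all add: agree_Suc diff_cong_0_iff)
  have "[\<phi> i (m x' y' z') - \<phi> i (m x y z) = (\<phi> i x' - \<phi> i x) - (\<phi> i y' - \<phi> i y)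
    + (\<phi> i z' - \<phi> i z)] (mod int (p i))"
    using Suc.prems A by (intro affine_m) (simp_all add: agree_Suc)
  also have "[(\<phi> i x' - \<phi> i x) - (\<phi> i y' - \<phi> i y) + (\<phi> i z' - \<phi> i z) = 0 - 0 + 0] (mod int (p i))"
    by (intro cong_add cong_diff c)
  finally have "[\<phi> i (m x' y' z') - \<phi> i (m x y z) = 0] (mod int (p i))" by simp
  with Suc show ?case by (simp add: agree_Suc diff_cong_0_iff)
qed simp

text \<open>
  On each coordinate, \<open>f\<close> is multiplication by \<open>c\<close> plus a function of the preceding coordinates. The
  factor is the same integer for all primes.
\<close>

definition slope :: "int \<Rightarrow> ('a \<Rightarrow> 'a) \<Rightarrow> bool" where
  "slope c f \<longleftrightarrow> f \<in> A \<rightarrow> A \<and> (\<forall>i<n. \<forall>x\<in>A. \<forall>y\<in>A. agree i x y \<longrightarrow>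
     [\<phi> i (f y) - \<phi> i (f x) = c * (\<phi> i y - \<phi> i x)] (mod int (p i)))"

lemma slopeD: "slope c f \<Longrightarrow> i < n \<Longrightarrow> x \<in> A \<Longrightarrow> y \<in> A \<Longrightarrow> agree i x y \<Longrightarrow>
    [\<phi> i (f y) - \<phi> i (f x) = c * (\<phi> i y - \<phi> i x)] (mod int (p i))"
  unfolding slope_def by simp

lemma slope_in: "slope c f \<Longrightarrow> x \<in> A \<Longrightarrow> f x \<in> A"
  by (auto simp: slope_def)

lemma slope_agree:
  assumes f: "slope c f" and A: "x \<in> A" "y \<in> A" and "i \<le> n" "agree i x y"
  shows "agree i (f x) (f y)"
  using assms(4-)
proof (induction i)
  case (Suc i)
  then have "[\<phi> i y - \<phi> i x = 0] (mod int (p i))"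
    by (simp add: agree_Suc diff_cong_0_iff)
  then have "[c * (\<phi> i y - \<phi> i x) = c * 0] (mod int (p i))" by (rule cong_scalar_left)
  with slopeD[OF f _ A, of i] Suc.prems have "[\<phi> i (f y) - \<phi> i (f x) = c * 0] (mod int (p i))"
    using cong_trans by (simp add: agree_Suc) blast
  with Suc show ?case by (simp add: agree_Suc diff_cong_0_iff)
qed simp

lemma slope_funpow:
  assumes f: "slope c f"
  shows "slope (c ^ k) (f ^^ k)"
proof (induction k)
  case (Suc k)
  show ?case unfolding slope_def
  proof (intro conjI allI impI ballI)
    show "f ^^ Suc k \<in> A \<rightarrow> A" using slope_in[OF f] slope_in[OF Suc] by simp
    fix i x y assume i: "i < n" and A: "x \<in> A" "y \<in> A" and a: "agree i x y"
    have "[\<phi> i (f ((f ^^ k) y)) - \<phi> i (f ((f ^^ k) x))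
      = c * (\<phi> i ((f ^^ k) y) - \<phi> i ((f ^^ k) x))] (mod int (p i))"
      using i A a slope_in[OF Suc] slope_agree[OF Suc A _ a] by (intro slopeD[OF f]) simp_all
    also have "[c * (\<phi> i ((f ^^ k) y) - \<phi> i ((f ^^ k) x))
      = c * (c ^ k * (\<phi> i y - \<phi> i x))] (mod int (p i))"
      by (rule cong_scalar_left[OF slopeD[OF Suc i A a]])
    finally show "[\<phi> i ((f ^^ Suc k) y) - \<phi> i ((f ^^ Suc k) x)
      = c ^ Suc k * (\<phi> i y - \<phi> i x)] (mod int (p i))"
      by (simp add: mult.assoc)
  qed
qed (auto simp: slope_def)

text \<open>
  The sum of \<open>k\<close> copies of \<open>x\<close> when \<open>m x u y\<close> is read as \<open>x + y\<close>.
\<close>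

primrec mult :: "nat \<Rightarrow> 'a \<Rightarrow> 'a" where
  "mult 0 x = u"
| "mult (Suc k) x = m x u (mult k x)"

lemma slope_mult: "slope (int k) (mult k)"
proof (induction k)
  case (Suc k)
  show ?case unfolding slope_def
  proof (intro conjI allI impI ballI)
    show "mult (Suc k) \<in> A \<rightarrow> A" using slope_in[OF Suc] by simp
    fix i x y assume i: "i < n" and A: "x \<in> A" "y \<in> A" and a: "agree i x y"
    have "[\<phi> i (m y u (mult k y)) - \<phi> i (m x u (mult k x)) = (\<phi> i y - \<phi> i x) - (\<phi> i u - \<phi> i u)
      + (\<phi> i (mult k y) - \<phi> i (mult k x))] (mod int (p i))"
      using i A a slope_in[OF Suc] slope_agree[OF Suc A _ a] by (intro affine_m) simp_all
    also have "[(\<phi> i y - \<phi> i x) - (\<phi> i u - \<phi> i u) + (\<phi> i (mult k y) - \<phi> i (mult k x))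
      = (\<phi> i y - \<phi> i x) - (\<phi> i u - \<phi> i u) + int k * (\<phi> i y - \<phi> i x)] (mod int (p i))"
      by (rule cong_add[OF cong_refl slopeD[OF Suc i A a]])
    finally show "[\<phi> i (mult (Suc k) y) - \<phi> i (mult (Suc k) x)
      = int (Suc k) * (\<phi> i y - \<phi> i x)] (mod int (p i))"
      by (simp add: algebra_simps)
  qed
qed (simp add: slope_def)

lemma pol_mult: "pol N f \<Longrightarrow> pol N (\<lambda>xs. mult k (f xs))"
  by (induction k) (simp_all add: pol_m pol_const)

lemma pol_funpow:
  assumes "\<And>f. pol N f \<Longrightarrow> pol N (\<lambda>xs. g (f xs))" "pol N f"
  shows "pol N (\<lambda>xs. (g ^^ k) (f xs))"
  by (induction k) (simp_all add: assms)

definition primes :: "nat set" where "primes = p ` {..<n}"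

definition retraction :: "nat \<Rightarrow> ('a \<Rightarrow> 'a) \<Rightarrow> bool" where
  "retraction q e \<longleftrightarrow> (\<forall>N f. pol N f \<longrightarrow> pol N (\<lambda>xs. e (f xs))) \<and> (\<forall>x\<in>A. e x \<in> A \<and> e (e x) = e x) \<and>
     (\<forall>i<n. \<forall>x\<in>A. \<forall>y\<in>A. agree i x y \<longrightarrow>
       [\<phi> i (e y) - \<phi> i (e x) = (if p i = q then \<phi> i y - \<phi> i x else 0)] (mod int (p i)))"

text \<open>
  Let \<open>Q\<close> be the product of the primes other than \<open>q\<close>. By Fermat, \<open>Q ^ (q - 1)\<close> is \<open>1\<close> modulo \<open>q\<close> and
  it is \<open>0\<close> modulo the other primes, and its positive powers have the same residues. So every positive
  power of this multiple has the required slopes, and one of them is idempotent.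
\<close>

lemma exists_retraction:
  assumes "q \<in> primes"
  shows "\<exists>e. retraction q e"
proof -
  have prime_primes: "prime r" if "r \<in> primes" for r
    using that prime by (auto simp: primes_def)
  have fin_primes: "finite primes" by (simp add: primes_def)
  define Q where "Q = \<Prod>(primes - {q})"
  define c where "c = Q ^ (q - 1)"
  have q: "prime q" by (rule prime_primes[OF assms])
  have "\<not> q dvd Q"
  proof
    assume "q dvd Q"
    then obtain r where "r \<in> primes - {q}" "q dvd r"
      using q fin_primes unfolding Q_def by (auto simp: prime_dvd_prod_iff)
    then show False using prime_primes primes_dvd_imp_eq[OF q] by blast
  qed
  then have c_q: "[c = 1] (mod q)" unfolding c_def by (rule fermat_theorem[OF q])
  have c_r: "r dvd c" if "r \<in> primes" "r \<noteq> q" for r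
  proof -
    have "r dvd Q" unfolding Q_def using that fin_primes by (intro dvd_prodI) auto
    moreover have "q - 1 \<noteq> 0" using prime_gt_1_nat[OF q] by simp
    ultimately show ?thesis unfolding c_def by (simp add: dvd_power_le dvd_trans[OF _ dvd_power])
  qed
  have "mult c \<in> A \<rightarrow> A" using slope_mult by (simp add: slope_def)
  then obtain k where k: "1 \<le> k" "\<forall>x\<in>A. (mult c ^^ k) ((mult c ^^ k) x) = (mult c ^^ k) x"
    using idempotent_power[OF fin] by metis
  have sl: "slope (int c ^ k) (mult c ^^ k)" by (rule slope_funpow[OF slope_mult])
  have "[int c ^ k = (if p i = q then 1 else 0)] (mod int (p i))" if "i < n" for i
  proof (cases "p i = q")
    case True
    have "[int c = 1] (mod int q)" using c_q by (metis cong_int_iff of_nat_1)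
    from cong_pow[OF this, of k] show ?thesis using True by simp
  next
    case False
    have "p i \<in> primes" using that by (simp add: primes_def)
    then have "p i dvd c ^ k" using c_r[of "p i"] False k(1)
      by (simp add: dvd_trans[OF _ dvd_power])
    then have "int (p i) dvd int (c ^ k)" by (simp only: int_dvd_int_iff)
    then show ?thesis using False by (simp add: cong_0_iff)
  qed
  note sc = this
  have "retraction q (mult c ^^ k)" unfolding retraction_def
  proof (intro conjI allI impI ballI)
    show "pol N (\<lambda>xs. (mult c ^^ k) (f xs))" if "pol N f" for N f
      by (rule pol_funpow[OF pol_mult that])
    show "(mult c ^^ k) x \<in> A" "(mult c ^^ k) ((mult c ^^ k) x) = (mult c ^^ k) x" if "x \<in> A" for x
      using slope_in[OF sl that] k(2) that by auto
    fix i x y assume i: "i < n" and A: "x \<in> A" "y \<in> A" and a: "agree i x y"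
    have "[int c ^ k * (\<phi> i y - \<phi> i x) = (if p i
      = q then 1 else 0) * (\<phi> i y - \<phi> i x)] (mod int (p i))"
      by (rule cong_scalar_right[OF sc[OF i]])
    from cong_trans[OF slopeD[OF sl i A a] this]
    show "[\<phi> i ((mult c ^^ k) y) - \<phi> i ((mult c ^^ k) x) = (if p i
      = q then \<phi> i y - \<phi> i x else 0)] (mod int (p i))"
      by (simp split: if_splits)
  qed
  then show ?thesis by blast
qed

end

locale retracted = coordinatized +
  fixes e :: "nat \<Rightarrow> 'a \<Rightarrow> 'a"
  assumes e: "q \<in> primes \<Longrightarrow> retraction q (e q)"
begin

lemma pol_e: "q \<in> primes \<Longrightarrow> pol N f \<Longrightarrow> pol N (\<lambda>xs. e q (f xs))"
  using e unfolding retraction_def by blast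

lemma e_in [simp]: "q \<in> primes \<Longrightarrow> x \<in> A \<Longrightarrow> e q x \<in> A"
  using e unfolding retraction_def by blast

lemma e_e [simp]: "q \<in> primes \<Longrightarrow> x \<in> A \<Longrightarrow> e q (e q x) = e q x"
  using e unfolding retraction_def by blast

lemma e_diff:
  "q \<in> primes \<Longrightarrow> i < n \<Longrightarrow> x \<in> A \<Longrightarrow> y \<in> A \<Longrightarrow> agree i x y \<Longrightarrow>
    [\<phi> i (e q y) - \<phi> i (e q x) = (if p i = q then \<phi> i y - \<phi> i x else 0)] (mod int (p i))"
  using e unfolding retraction_def by blast

lemma p_in_primes [simp]: "i < n \<Longrightarrow> p i \<in> primes"
  by (simp add: primes_def)

text \<open>
  On its range, \<open>e q\<close> is the identity, but a coordinate \<open>i\<close> of \<open>e q x\<close> with \<open>p i \<noteq> q\<close> is determined by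
  the preceding coordinates of \<open>x\<close>. So an element of the range is determined by its
  coordinates of order \<open>q\<close>.
\<close>

lemma agree_range:
  assumes q: "q \<in> primes" and A: "x \<in> A" "y \<in> A" and fixed: "e q x = x" "e q y = y"
    and "i \<le> n" "\<forall>j<i. p j = q \<longrightarrow> [\<phi> j x = \<phi> j y] (mod int (p j))"
  shows "agree i x y"
  using assms(6-)
proof (induction i)
  case (Suc i)
  then have a: "agree i x y" by simp
  have "[\<phi> i x = \<phi> i y] (mod int (p i))"
  proof (cases "p i = q")
    case False
    then have "[\<phi> i y - \<phi> i x = 0] (mod int (p i))"
      using e_diff[OF q _ A a] Suc.prems fixed by simp
    then show ?thesis by (simp add: diff_cong_0_iff)
  qed (use Suc.prems in simp)
  with a show ?case by (simp add: agree_Suc)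
qed simp

lemma agree_e:
  assumes q: "q \<in> primes" and A: "x \<in> A" "y \<in> A" and "i \<le> n" "agree i x y"
  shows "agree i (e q x) (e q y)"
  using assms(4-)
proof (induction i)
  case (Suc i)
  then have a: "agree i x y" and c: "[\<phi> i y - \<phi> i x = 0] (mod int (p i))"
    by (simp_all add: agree_Suc diff_cong_0_iff)
  have "[\<phi> i (e q y) - \<phi> i (e q x) = (if p i = q then \<phi> i y - \<phi> i x else 0)] (mod int (p i))"
    using Suc.prems by (intro e_diff q A a) simp
  also have "[(if p i = q then \<phi> i y - \<phi> i x else 0) = 0] (mod int (p i))"
    using c by (cases "p i = q") simp_all
  finally show ?case using Suc a by (simp add: agree_Suc diff_cong_0_iff)
qed simp

text \<open>
  Starting from \<open>x\<close>, the element is corrected one coordinate after the other until its image under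
  each retraction \<open>e q\<close> is \<open>t q\<close>. Read \<open>m w v v'\<close> as \<open>w - v + v'\<close>: step \<open>i\<close> adds the difference
  between prescribed and current image under \<open>e (p i)\<close>. This difference vanishes in the coordinates before \<open>i\<close>,
  which are correct already.
\<close>

primrec newton :: "(nat \<Rightarrow> 'a) \<Rightarrow> 'a \<Rightarrow> nat \<Rightarrow> 'a" where
  "newton t x 0 = x"
| "newton t x (Suc i) = m (newton t x i) (e (p i) (newton t x i)) (t (p i))"

lemma newton_in:
  assumes "x \<in> A" "\<And>q. q \<in> primes \<Longrightarrow> t q \<in> A"
  shows "i \<le> n \<Longrightarrow> newton t x i \<in> A"
  by (induction i) (simp_all add: assms)

text \<open>
  Step \<open>i\<close> leaves the coordinates before \<open>i\<close> unchanged and makes coordinate \<open>i\<close> of the image under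
  \<open>e (p i)\<close> correct. For the other \<open>q\<close>, the images agree with their targets in coordinate \<open>i\<close> because
  they lie in the range of \<open>e q\<close> and agree with them before \<open>i\<close>.
\<close>

lemma newton_agree:
  assumes x: "x \<in> A" and t: "\<And>q. q \<in> primes \<Longrightarrow> t q \<in> A \<and> e q (t q) = t q"
  shows "i \<le> n \<Longrightarrow> q \<in> primes \<Longrightarrow> agree i (e q (newton t x i)) (t q)"
proof (induction i arbitrary: q)
  case (Suc i)
  let ?w = "newton t x i" and ?w' = "newton t x (Suc i)"
  let ?l = "p i"
  have i: "i < n" and l: "?l \<in> primes" using Suc.prems by simp_all
  have wA: "?w \<in> A" "?w' \<in> A" using newton_in[OF x] t Suc.prems by (simp_all del: newton.simps)
  have IH: "agree i (e r ?w) (t r)" if "r \<in> primes" for r using Suc.IH[OF _ that] i by simp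
  have "agree i (m ?w (e ?l ?w) (e ?l ?w)) (m ?w (e ?l ?w) (t ?l))"
    using wA(1) l t i IH[OF l] by (intro agree_m) simp_all
  then have ww: "agree i ?w ?w'" using wA(1) l by simp
  have diff: "[\<phi> i ?w' - \<phi> i ?w = \<phi> i (t ?l) - \<phi> i (e ?l ?w)] (mod int ?l)"
    using affine_m[OF i, of ?w ?w "e ?l ?w" "e ?l ?w" "e ?l ?w" "t ?l"] wA(1) l t IH[OF l] by simp
  have ee: "agree i (e q ?w') (t q)"
    using agree_trans[OF agree_sym[OF agree_e[OF Suc.prems(2) wA _ ww]] IH[OF Suc.prems(2)]] i
      by simp
  have "[\<phi> i (e q ?w') = \<phi> i (t q)] (mod int (p i))"
  proof (cases "p i = q")
    case True
    have "[\<phi> i (e q ?w') - \<phi> i (e q ?w) = \<phi> i ?w' - \<phi> i ?w] (mod int (p i))"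
      using e_diff[OF Suc.prems(2) i wA ww] True by simp
    also note diff
    finally have "[\<phi> i (e q ?w') - \<phi> i (e q ?w) = \<phi> i (t q) - \<phi> i (e q ?w)] (mod int (p i))"
      using True by simp
    from cong_add[OF this cong_refl[of "\<phi> i (e q ?w)"]] show ?thesis by simp
  next
    case False
    have "[\<phi> i (e q (t q)) - \<phi> i (e q (e q ?w')) = 0] (mod int (p i))"
      using e_diff[OF Suc.prems(2) i _ _ ee] False wA(2) t Suc.prems(2) by simp
    then show ?thesis using wA(2) t Suc.prems(2)
      by (simp add: diff_cong_0_iff del: newton.simps)
  qed
  with ee show ?case by (simp add: agree_Suc)
qed simp

definition target :: "'a \<Rightarrow> 'a \<Rightarrow> 'a \<Rightarrow> nat \<Rightarrow> 'a" where
  "target x y z q = e q (m (e q x) (e q y) (e q z))"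

definition sep :: "'a \<Rightarrow> 'a \<Rightarrow> 'a \<Rightarrow> 'a" where
  "sep x y z = newton (target x y z) x n"

definition psi :: "nat \<Rightarrow> 'a \<Rightarrow> int" where "psi i x = \<phi> i (e (p i) x)"

lemma target_in: "x \<in> A \<Longrightarrow> y \<in> A \<Longrightarrow> z \<in> A \<Longrightarrow> q \<in> primes \<Longrightarrow> target x y z q \<in> A"
  by (simp add: target_def)

lemma sep_in: "x \<in> A \<Longrightarrow> y \<in> A \<Longrightarrow> z \<in> A \<Longrightarrow> sep x y z \<in> A"
  unfolding sep_def by (rule newton_in) (simp_all add: target_in)

text \<open>
  The operation \<open>sep\<close> thus acts on the range of each retraction \<open>e q\<close> separately, and so makes \<open>A\<close> a
  direct product of algebras of prime power order.
\<close>

lemma e_sep: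
  assumes A: "x \<in> A" "y \<in> A" "z \<in> A" and q: "q \<in> primes"
  shows "e q (sep x y z) = target x y z q"
proof (rule agree_eq)
  show "agree n (e q (sep x y z)) (target x y z q)"
    unfolding sep_def using A q by (intro newton_agree) (simp_all add: target_def)
qed (use A q in \<open>simp_all add: sep_in target_in\<close>)

lemma pol_sep:
  assumes f: "pol N f" and g: "pol N g" and h: "pol N h"
  shows "pol N (\<lambda>xs. sep (f xs) (g xs) (h xs))"
proof -
  have t: "pol N (\<lambda>xs. target (f xs) (g xs) (h xs) q)" if "q \<in> primes" for q
    unfolding target_def using that f g h by (intro pol_e pol_m)
  have "pol N (\<lambda>xs. newton (target (f xs) (g xs) (h xs)) (f xs) i)" if "i \<le> n" for i
    using that by (induction i) (simp_all add: f pol_m pol_e t)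
  then show ?thesis by (simp add: sep_def)
qed

lemma psi_separating:
  assumes A: "x \<in> A" "y \<in> A" and eq: "\<And>i. i < n \<Longrightarrow> [psi i x = psi i y] (mod int (p i))"
  shows "x = y"
proof -
  have e_eq: "e q x = e q y" if q: "q \<in> primes" for q
  proof (rule agree_eq)
    show "agree n (e q x) (e q y)"
      by (rule agree_range[OF q]) (use A q eq[unfolded psi_def] in auto)
  qed (use A q in simp_all)
  have "agree i x y" if "i \<le> n" for i
    using that
  proof (induction i)
    case (Suc i)
    then have "[\<phi> i y - \<phi> i x = 0] (mod int (p i))"
      using cong_sym[OF e_diff[of "p i" i x y]] A e_eq[of "p i"] by simp
    with Suc show ?case by (simp add: agree_Suc diff_cong_0_iff)
  qed simp
  with A show ?thesis by (intro agree_eq) simp_all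
qed

lemma malcev_sep: "malcev A sep"
proof
  fix x y z assume A: "x \<in> A" "y \<in> A"
  show "sep x y y = x"
    using A by (intro psi_separating) (simp_all add: sep_in psi_def e_sep target_def)
  show "sep y y x = x"
    using A by (intro psi_separating) (simp_all add: sep_in psi_def e_sep target_def)
qed (rule sep_in)

text \<open>
  If \<open>x\<close> and \<open>x'\<close> agree in the preceding coordinates of order \<open>q\<close>, then \<open>e q x\<close> and \<open>e q x'\<close> agree in all
  preceding coordinates by \<open>agree_range\<close>, and \<open>m\<close> is affine there.
\<close>

lemma psi_sep:
  assumes i: "i < n" and A: "x \<in> A" "x' \<in> A" "y \<in> A" "y' \<in> A" "z \<in> A" "z' \<in> A"
    and x: "\<And>j. j < i \<Longrightarrow> p j = p i \<Longrightarrow> [psi j x = psi j x'] (mod int (p i))"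
    and y: "\<And>j. j < i \<Longrightarrow> p j = p i \<Longrightarrow> [psi j y = psi j y'] (mod int (p i))"
    and z: "\<And>j. j < i \<Longrightarrow> p j = p i \<Longrightarrow> [psi j z = psi j z'] (mod int (p i))"
  shows "[psi i (sep x' y' z') - psi i (sep x y z)
      = (psi i x' - psi i x) - (psi i y' - psi i y) + (psi i z' - psi i z)] (mod int (p i))"
proof -
  let ?q = "p i"
  have q: "?q \<in> primes" using i by simp
  have ag: "agree i (e ?q v) (e ?q v')"
    if "v \<in> A" "v' \<in> A" "\<And>j. j < i \<Longrightarrow> p j = p i \<Longrightarrow> [psi j v = psi j v'] (mod int (p i))" for v v'
    by (rule agree_range[OF q]) (use that(1,2) that(3)[unfolded psi_def] i q in auto)
  have ags: "agree i (e ?q x) (e ?q x')" "agree i (e ?q y) (e ?q y')" "agree i (e ?q z) (e ?q z')"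
    by (rule ag[OF A(1,2) x] ag[OF A(3,4) y] ag[OF A(5,6) z]; assumption)+
  let ?a = "m (e ?q x) (e ?q y) (e ?q z)" and ?a' = "m (e ?q x') (e ?q y') (e ?q z')"
  have aA: "?a \<in> A" "?a' \<in> A" using A q by simp_all
  have "agree i ?a ?a'" using A q i ags by (intro agree_m) simp_all
  from e_diff[OF q i aA this]
  have "[psi i (sep x' y' z') - psi i (sep x y z) = \<phi> i ?a' - \<phi> i ?a] (mod int ?q)"
    using A q by (simp add: psi_def e_sep target_def)
  also have "[\<phi> i ?a' - \<phi> i ?a = (psi i x' - psi i x) - (psi i y' - psi i y)
    + (psi i z' - psi i z)] (mod int ?q)"
    unfolding psi_def using A q i ags by (intro affine_m) simp_all
  finally show ?thesis .
qed

end

section \<open>Functions of bounded degree\<close>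

text \<open>
  Sums of juntas, functions that depend, modulo \<open>p\<close>, on membership in \<open>S\<close> of at most \<open>d\<close> elements.
  They stand for polynomials of degree at most \<open>d\<close>, evaluated at a choice \<open>S\<close> of blocks: a
  monomial of degree \<open>d\<close> involves at most \<open>d\<close> blocks.
\<close>

inductive junta_sum :: "nat \<Rightarrow> nat \<Rightarrow> (nat set \<Rightarrow> int) \<Rightarrow> bool" for p d where
  junta: "finite V \<Longrightarrow> card V \<le> d \<Longrightarrow> (\<And>S T. S \<inter> V = T \<inter> V \<Longrightarrow> [F S = F T] (mod int p)) \<Longrightarrow> junta_sum p d F"
| add: "junta_sum p d F \<Longrightarrow> junta_sum p d G \<Longrightarrow> junta_sum p d (\<lambda>S. F S + G S)"

lemma junta_sum_const: "junta_sum p d (\<lambda>S. c)"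
  by (rule junta_sum.junta[of "{}"]) simp_all

lemma junta_sum_cong:
  assumes "junta_sum p d F" "\<And>S. [F S = G S] (mod int p)"
  shows "junta_sum p d G"
proof -
  have "[G S - F S = G T - F T] (mod int p)" for S T
    using cong_trans[of "G S - F S" 0 "int p" "G T - F T"] assms(2)
    by (simp add: diff_cong_0_iff cong_sym_eq[of 0])
  then have "junta_sum p d (\<lambda>S. G S - F S)" by (intro junta_sum.junta[of "{}"]) simp_all
  from junta_sum.add[OF assms(1) this] show ?thesis by simp
qed

lemma junta_sum_mono:
  assumes "junta_sum p d F" "d \<le> d'"
  shows "junta_sum p d' F"
  using assms(1)
proof induction
  case (junta V F)
  show ?case by (rule junta_sum.junta[of V]) (use junta assms(2) in auto)
qed (rule junta_sum.add)

lemma junta_sum_uminus: "junta_sum p d F \<Longrightarrow> junta_sum p d (\<lambda>S. - F S)"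
proof (induction rule: junta_sum.induct)
  case (junta V F)
  show ?case by (rule junta_sum.junta[of V]) (use junta in \<open>auto simp: cong_minus_minus_iff\<close>)
next
  case (add F G)
  from junta_sum.add[OF add.IH] show ?case by simp
qed

lemma junta_sum_diff: "junta_sum p d F \<Longrightarrow> junta_sum p d G \<Longrightarrow> junta_sum p d (\<lambda>S. F S - G S)"
  using junta_sum.add[OF _ junta_sum_uminus, of p d F G] by simp

lemma junta_sum_sum:
  "(\<And>i. i \<in> I \<Longrightarrow> junta_sum p d (F i)) \<Longrightarrow> junta_sum p d (\<lambda>S. \<Sum>i\<in>I. F i S)"
  by (induction I rule: infinite_finite_induct) (simp_all add: junta_sum_const junta_sum.add)

lemma junta_sum_mult:
  assumes F: "junta_sum p d F" and G: "junta_sum p d' G"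
  shows "junta_sum p (d + d') (\<lambda>S. F S * G S)"
  using F
proof induction
  case F: (junta V F)
  from G show ?case
  proof induction
    case G: (junta W G)
    show ?case
    proof (rule junta_sum.junta[of "V \<union> W"])
      show "finite (V \<union> W)" using F(1) G(1) by simp
      show "card (V \<union> W) \<le> d + d'" using card_Un_le[of V W] F(2) G(2) by linarith
      fix S T assume "S \<inter> (V \<union> W) = T \<inter> (V \<union> W)"
      then have "S \<inter> V = T \<inter> V" "S \<inter> W = T \<inter> W" by blast+
      then show "[F S * G S = F T * G T] (mod int p)" using F(3) G(3) by (intro cong_mult)
    qed
  next
    case (add G H)
    from junta_sum.add[OF add.IH] show ?case by (simp add: algebra_simps)
  qed
next
  case (add F H)
  from junta_sum.add[OF add.IH] show ?case by (simp add: algebra_simps)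
qed

lemma junta_sum_power: "junta_sum p d F \<Longrightarrow> junta_sum p (k * d) (\<lambda>S. F S ^ k)"
proof (induction k)
  case (Suc k)
  from junta_sum_mult[OF Suc.prems Suc.IH[OF Suc.prems]] show ?case by simp
qed (simp add: junta_sum_const)

lemma int_fermat:
  assumes "prime p" "\<not> [x = 0] (mod int p)"
  shows "[x ^ (p - 1) = 1] (mod int p)"
proof -
  define y where "y = nat (x mod int p)"
  have "0 < int p" using prime_gt_0_nat[OF assms(1)] by simp
  then have y: "[x = int y] (mod int p)" by (simp add: y_def cong_def)
  then have "\<not> p dvd y" using assms(2) cong_trans by (auto simp flip: cong_0_iff cong_int_iff)
  then have "[int (y ^ (p - 1)) = int 1] (mod int p)"
    unfolding cong_int_iff by (rule fermat_theorem[OF assms(1)])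
  then show ?thesis using cong_trans[OF cong_pow[OF y, of "p - 1"]] by simp
qed

text \<open>
  A function of finitely many residues modulo \<open>p\<close> is a polynomial of degree at most \<open>p - 1\<close> in each of
  them. For one residue \<open>x\<close> this is interpolation by \<open>1 - (x - v) ^ (p - 1)\<close>, which by Fermat is \<open>1\<close> if
  \<open>x = v\<close> and \<open>0\<close> otherwise. The others follow by induction.
\<close>

lemma junta_sum_compose:
  assumes p: "prime p" and "finite K" "\<And>k. k \<in> K \<Longrightarrow> junta_sum p d (U k)"
    and "\<And>S T. (\<And>k. k \<in> K \<Longrightarrow> [U k S = U k T] (mod int p)) \<Longrightarrow> [G S = G T] (mod int p)"
  shows "junta_sum p (card K * ((p - 1) * d)) G"
  using assms(2-)
proof (induction K arbitrary: G rule: finite_induct)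
  case empty
  show ?case by (rule junta_sum.junta[of "{}"]) (use empty in simp_all)
next
  case (insert k K)
  define P where "P = (\<lambda>v S T. [U k T = int v] (mod int p) \<and> (\<forall>j\<in>K. [U j T = U j S] (mod int p)))"
  \<comment> \<open>\<open>H v\<close> is \<open>G\<close> with the residue of \<open>U k\<close> fixed to \<open>v\<close>; it is \<open>0\<close> where no argument with this
    residue and the given residues of the other functions exists.\<close>
  define H where "H = (\<lambda>v S. if \<exists>T. P v S T then G (SOME T. P v S T) else 0)"
  have H: "junta_sum p (card K * ((p - 1) * d)) (H v)" for v
  proof (rule insert.IH)
    show "junta_sum p d (U j)" if "j \<in> K" for j using insert.prems(1) that by simp
    fix S S' assume eq: "\<And>j. j \<in> K \<Longrightarrow> [U j S = U j S'] (mod int p)"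
    have "P v S = P v S'"
      unfolding P_def
    proof (intro ext conj_cong refl ball_cong)
      fix T j assume "j \<in> K"
      from eq[OF this] show "[U j T = U j S] (mod int p) \<longleftrightarrow> [U j T = U j S'] (mod int p)"
        by (simp add: cong_def)
    qed
    then have "H v S = H v S'" unfolding H_def by (simp only:)
    then show "[H v S = H v S'] (mod int p)" by simp
  qed
  let ?I = "\<lambda>v S. 1 - (U k S - int v) ^ (p - 1)"
  have "junta_sum p ((p - 1) * d) (?I v)" for v
    using insert.prems(1)[of k]
    by (intro junta_sum_diff junta_sum_power junta_sum_const) simp
  then have "junta_sum p ((p - 1) * d + card K * ((p - 1) * d)) (\<lambda>S. \<Sum>v<p. ?I v S * H v S)"
    by (intro junta_sum_sum junta_sum_mult H)
  moreover have "[(\<Sum>v<p. ?I v S * H v S) = G S] (mod int p)" for S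
  proof -
    define w where "w = nat (U k S mod int p)"
    have p0: "0 < int p" using prime_gt_0_nat[OF p] by simp
    then have w: "[U k S = int w] (mod int p)" "w < p"
      by (simp_all add: w_def cong_def nat_less_iff)
    have "[?I v S * H v S = (if v = w then G S else 0)] (mod int p)" if "v < p" for v
    proof (cases "v = w")
      case True
      have "P v S S" using w True by (simp add: P_def)
      then have "P v S (SOME T. P v S T)" by (rule someI)
      then have "[G (SOME T. P v S T) = G S] (mod int p)"
        using w(1) True unfolding P_def by (intro insert.prems(2)) (auto intro: cong_trans cong_sym)
      moreover have "H v S = G (SOME T. P v S T)" using \<open>P v S S\<close> unfolding H_def by auto
      ultimately have GH: "[H v S = G S] (mod int p)" by simp
      have "[U k S - int v = 0] (mod int p)" using cong_sym[OF w(1)] True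
        by (simp add: diff_cong_0_iff)
      then have "[(U k S - int v) ^ (p - 1) = 0 ^ (p - 1)] (mod int p)" by (rule cong_pow)
      moreover have "(0 :: int) ^ (p - 1) = 0" using prime_gt_1_nat[OF p] by simp
      ultimately have "[(U k S - int v) ^ (p - 1) = 0] (mod int p)" by (simp only:)
      then have "[?I v S = 1 - 0] (mod int p)" by (rule cong_diff[OF cong_refl])
      from cong_mult[OF this GH] show ?thesis using True by simp
    next
      case False
      have "\<not> [U k S - int v = 0] (mod int p)"
      proof
        assume "[U k S - int v = 0] (mod int p)"
        then have "[int v = int w] (mod int p)" using w(1)
          by (auto simp: diff_cong_0_iff intro: cong_trans)
        then have "[v = w] (mod p)" by (simp only: cong_int_iff)
        then show False using False that w(2) by (simp add: cong_def)
      qed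
      from int_fermat[OF p this] have "[?I v S = 1 - 1] (mod int p)"
        by (rule cong_diff[OF cong_refl])
      from cong_mult[OF this cong_refl[of "H v S"]] show ?thesis using False by simp
    qed
    then have "[(\<Sum>v<p. ?I v S * H v S) = (\<Sum>v<p. if v = w then G S else 0)] (mod int p)"
      by (intro cong_sum) simp
    then show ?thesis using w(2) by simp
  qed
  ultimately have "junta_sum p ((p - 1) * d + card K * ((p - 1) * d)) G" by (rule junta_sum_cong)
  then show ?case using insert.hyps by simp
qed

lemma alternating_sum_insert:
  fixes F :: "nat set \<Rightarrow> int"
  assumes "finite X" "b \<notin> X"
  shows "(\<Sum>S\<in>Pow (insert b X). (- 1) ^ card S * F S)
    = (\<Sum>S\<in>Pow X. (- 1) ^ card S * (F S - F (insert b S)))"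
proof -
  have "(\<Sum>S\<in>insert b ` Pow X. (- 1) ^ card S * F S)
      = (\<Sum>S\<in>Pow X. (- 1) ^ card (insert b S) * F (insert b S))"
    using assms(2) by (intro sum.reindex_cong[of "insert b"] inj_onI refl) auto
  also have "\<dots> = (\<Sum>S\<in>Pow X. - ((- 1) ^ card S * F (insert b S)))"
  proof (rule sum.cong)
    fix S assume "S \<in> Pow X"
    then have "finite S" "b \<notin> S" using assms finite_subset by auto
    then show "(- 1) ^ card (insert b S) * F (insert b S) = - ((- 1) ^ card S * F (insert b S))"
      by simp
  qed simp
  moreover have "(\<Sum>S\<in>Pow (insert b X). (- 1) ^ card S * F S)
      = (\<Sum>S\<in>Pow X. (- 1) ^ card S * F S) + (\<Sum>S\<in>insert b ` Pow X. (- 1) ^ card S * F S)"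
    unfolding Pow_insert using assms by (intro sum.union_disjoint) auto
  ultimately show ?thesis by (simp add: right_diff_distrib sum_subtractf sum_negf)
qed

text \<open>
  A function of fewer than \<open>N\<close> elements ignores one of them, and the sets with and without this element
  cancel.
\<close>

lemma junta_sum_alternating:
  assumes "junta_sum p d F" "d < N"
  shows "[(\<Sum>S\<in>Pow {..<N}. (- 1) ^ card S * F S) = 0] (mod int p)"
  using assms(1)
proof induction
  case (junta V F)
  have "\<not> {..<N} \<subseteq> V" using card_mono[OF junta(1), of "{..<N}"] junta(2) assms(2) by auto
  then obtain b where b: "b < N" "b \<notin> V" by auto
  define X where "X = {..<N} - {b}"
  have X: "{..<N} = insert b X" "finite X" "b \<notin> X" using b(1) by (auto simp: X_def)
  have "[(- 1) ^ card S * (F S - F (insert b S)) = 0] (mod int p)" for S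
  proof -
    have "[F S = F (insert b S)] (mod int p)" using b(2) by (intro junta(3)) auto
    then have "[F S - F (insert b S) = 0] (mod int p)"
      unfolding diff_cong_0_iff by (rule cong_sym)
    from cong_scalar_left[OF this] show ?thesis by simp
  qed
  then have "[(\<Sum>S\<in>Pow X. (- 1) ^ card S * (F S - F (insert b S))) = (\<Sum>S\<in>Pow X. 0)] (mod int p)"
    by (intro cong_sum)
  then show ?case unfolding X(1) alternating_sum_insert[OF X(2,3)] by simp
next
  case (add F G)
  from cong_add[OF add.IH] show ?case by (simp add: distrib_left sum.distrib)
qed

section \<open>Supernilpotence\<close>

text \<open>
  Coordinates of prime order for which the Mal'cev operation does not mix primes: its deviation from
  \<open>x - y + z\<close> in coordinate \<open>i\<close> is a function of the preceding coordinates for the same prime.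
\<close>

locale separated_coordinates = malcev A m for A :: "'a set" and m +
  fixes n :: nat and p :: "nat \<Rightarrow> nat" and \<psi> :: "nat \<Rightarrow> 'a \<Rightarrow> int"
  assumes prime: "i < n \<Longrightarrow> prime (p i)"
    and separating: "x \<in> A \<Longrightarrow> y \<in> A \<Longrightarrow> (\<And>i. i < n \<Longrightarrow> [\<psi> i x = \<psi> i y] (mod int (p i))) \<Longrightarrow> x = y"
    and affine: "i < n \<Longrightarrow> x \<in> A \<Longrightarrow> x' \<in> A \<Longrightarrow> y \<in> A \<Longrightarrow> y' \<in> A \<Longrightarrow> z \<in> A \<Longrightarrow> z' \<in> A \<Longrightarrow>
      (\<And>j. j < i \<Longrightarrow> p j = p i \<Longrightarrow> [\<psi> j x = \<psi> j x'] (mod int (p i))) \<Longrightarrow>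
      (\<And>j. j < i \<Longrightarrow> p j = p i \<Longrightarrow> [\<psi> j y = \<psi> j y'] (mod int (p i))) \<Longrightarrow>
      (\<And>j. j < i \<Longrightarrow> p j = p i \<Longrightarrow> [\<psi> j z = \<psi> j z'] (mod int (p i))) \<Longrightarrow>
      [\<psi> i (m x' y' z') - \<psi> i (m x y z)
        = (\<psi> i x' - \<psi> i x) - (\<psi> i y' - \<psi> i y) + (\<psi> i z' - \<psi> i z)] (mod int (p i))"
begin

text \<open>
  Captures what matters about the tuples \<open>select_blocks as bs S\<close>: each entry lies in one block \<open>b\<close>, and
  depends on \<open>S\<close> only through membership of \<open>b\<close>.
\<close>

definition block_selection :: "nat \<Rightarrow> (nat set \<Rightarrow> 'a list) \<Rightarrow> bool" where
  "block_selection N s \<longleftrightarrow> (\<forall>S. s S \<in> nlists N A) \<and>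
     (\<forall>i<N. \<exists>b. \<forall>S T. (b \<in> S \<longleftrightarrow> b \<in> T) \<longrightarrow> s S ! i = s T ! i)"

definition degree_le :: "nat \<Rightarrow> nat \<Rightarrow> bool" where
  "degree_le i d \<longleftrightarrow> (\<forall>N f s. pol N f \<longrightarrow> block_selection N s \<longrightarrow> junta_sum (p i) d (\<lambda>S. \<psi> i (f (s S))))"

lemma degree_le_mono: "degree_le i d \<Longrightarrow> d \<le> d' \<Longrightarrow> degree_le i d'"
  unfolding degree_le_def using junta_sum_mono by blast

text \<open>
  The deviation of \<open>m\<close> from \<open>x - y + z\<close> is a function of at most \<open>n\<close> coordinates of each of three
  arguments, all with residues modulo the same prime \<open>p i\<close>, so \<open>junta_sum_compose\<close> bounds its degree.
  The resulting bound also holds for the sum \<open>x - y + z\<close>, so it persists under nesting \<open>m\<close>; this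
  is why it does not depend on the operation.
\<close>

lemma degree_le_step:
  assumes i: "i < n" and lower: "\<And>j. j < i \<Longrightarrow> degree_le j d"
  shows "degree_le i (max 1 (3 * n * ((p i - 1) * d)))"
  unfolding degree_le_def
proof (intro allI impI)
  fix N f s assume "pol N f" and s: "block_selection N s"
  let ?d = "max 1 (3 * n * ((p i - 1) * d))"
  have sA: "s S \<in> nlists N A" for S using s by (simp add: block_selection_def)
  show "junta_sum (p i) ?d (\<lambda>S. \<psi> i (f (s S)))"
    using \<open>pol N f\<close>
  proof (induction rule: pol.induct)
    case (pol_proj k)
    then obtain b where b: "\<And>S T. (b \<in> S \<longleftrightarrow> b \<in> T) \<Longrightarrow> s S ! k = s T ! k"
      using s unfolding block_selection_def by blast
    show ?case
    proof (rule junta_sum.junta[of "{b}"])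
      fix S T assume "S \<inter> {b} = T \<inter> {b}"
      then have "b \<in> S \<longleftrightarrow> b \<in> T" by blast
      from b[OF this] show "[\<psi> i (s S ! k) = \<psi> i (s T ! k)] (mod int (p i))" by simp
    qed simp_all
  next
    case (pol_const c)
    show ?case by (rule junta_sum_const)
  next
    case (pol_m f g h)
    let ?fs = "\<lambda>k :: nat. if k = 0 then f else if k = 1 then g else h"
    let ?K = "{j. j < i \<and> p j = p i} \<times> {..<3 :: nat}"
    let ?U = "\<lambda>(j, k) S. \<psi> j (?fs k (s S))"
    let ?G = "\<lambda>S. \<psi> i (m (f (s S)) (g (s S)) (h (s S)))
      - (\<psi> i (f (s S)) - \<psi> i (g (s S)) + \<psi> i (h (s S)))"
    have in_A: "f (s S) \<in> A" "g (s S) \<in> A" "h (s S) \<in> A" for S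
      using pol_m.hyps pol_closed sA by blast+
    have "junta_sum (p i) (card ?K * ((p i - 1) * d)) ?G"
    proof (rule junta_sum_compose[OF prime[OF i], of ?K d ?U ?G])
      show "finite ?K" by simp
      fix jk assume "jk \<in> ?K"
      then obtain j k where jk: "jk = (j, k)" "j < i" "p j = p i" by auto
      have "pol N (?fs k)" using pol_m.hyps by simp
      with lower[OF jk(2)] s have "junta_sum (p j) d (\<lambda>S. \<psi> j (?fs k (s S)))"
        unfolding degree_le_def by blast
      then show "junta_sum (p i) d (?U jk)" using jk by simp
    next
      fix S T assume eq: "\<And>jk. jk \<in> ?K \<Longrightarrow> [?U jk S = ?U jk T] (mod int (p i))"
      have eqs: "[\<psi> j (?fs k (s S)) = \<psi> j (?fs k (s T))] (mod int (p i))"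
        if "j < i" "p j = p i" "k < 3" for j k
        using eq[of "(j, k)"] that by simp
      have "[\<psi> i (m (f (s T)) (g (s T)) (h (s T))) - \<psi> i (m (f (s S)) (g (s S)) (h (s S)))
          = (\<psi> i (f (s T)) - \<psi> i (f (s S))) - (\<psi> i (g (s T)) - \<psi> i (g (s S)))
            + (\<psi> i (h (s T)) - \<psi> i (h (s S)))] (mod int (p i))"
        using eqs[of _ 0] eqs[of _ 1] eqs[of _ 2] by (intro affine i in_A) simp_all
      from cong_diff[OF this cong_refl[of "(\<psi> i (f (s T)) - \<psi> i (f (s S)))
        - (\<psi> i (g (s T)) - \<psi> i (g (s S)))
            + (\<psi> i (h (s T)) - \<psi> i (h (s S)))"]]
      have "[?G T - ?G S = 0] (mod int (p i))" by (simp add: algebra_simps)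
      then show "[?G S = ?G T] (mod int (p i))" by (simp only: diff_cong_0_iff)
    qed
    moreover have "card ?K * ((p i - 1) * d) \<le> ?d"
    proof -
      have "card {j. j < i \<and> p j = p i} \<le> card {..<n}" using i by (intro card_mono) auto
      then have "card ?K \<le> 3 * n" by (simp add: card_cartesian_product)
      then have "card ?K * ((p i - 1) * d) \<le> 3 * n * ((p i - 1) * d)" by (rule mult_le_mono1)
      then show ?thesis by (rule max.coboundedI2)
    qed
    ultimately have "junta_sum (p i) ?d ?G" by (rule junta_sum_mono)
    from junta_sum.add[OF this junta_sum.add[OF junta_sum_diff[OF pol_m.IH(1,2)] pol_m.IH(3)]]
    show ?case by simp
  qed
qed

lemma bounded_degree: "\<exists>d. \<forall>i<n. degree_le i d"
proof -
  have "\<exists>d. \<forall>j<i. degree_le j d" if "i \<le> n" for i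
    using that
  proof (induction i)
    case (Suc i)
    then obtain d where d: "\<forall>j<i. degree_le j d" by auto
    then have "degree_le i (max 1 (3 * n * ((p i - 1) * d)))"
      using Suc.prems by (intro degree_le_step) simp_all
    then have "\<forall>j<Suc i. degree_le j (max d (max 1 (3 * n * ((p i - 1) * d))))"
      using d degree_le_mono by (metis less_Suc_eq max.cobounded1 max.cobounded2)
    then show ?case by blast
  qed simp
  then show ?thesis by blast
qed

text \<open>
  In the alternating sum of a coordinate of \<open>f\<close> over all choices of blocks, pair the choices that differ
  in the last block. By hypothesis all pairs cancel except the one in the conclusion, and the sum is
  \<open>0\<close> as there are more blocks than the degree.
\<close>

lemma centralizes_Id:
  assumes m0: "\<And>x y z. x \<in> A \<Longrightarrow> y \<in> A \<Longrightarrow> z \<in> A \<Longrightarrow> m0 [x, y, z] = m x y z"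
    and deg: "\<forall>i<n. degree_le i d" and k: "d \<le> k"
  shows "centralizes A {(3, m0)} (replicate (k + 1) (A \<times> A)) (Id_on A)"
  unfolding centralizes_def Let_def length_replicate
proof (intro allI impI)
  fix f as bs
  assume len: "length as = k + 1" "length bs = k + 1"
    and rel: "\<forall>i<k + 1. list_all2 (\<lambda>x y. (x, y) \<in> replicate (k + 1) (A \<times> A) ! i) (as ! i) (bs ! i)"
    and f: "(sum_list (map length as), f) \<in> polynomial_operations A {(3, m0)}"
    and eq: "\<forall>S. S \<subset> {..<k + 1 - 1} \<longrightarrow>
      (f (select_blocks as bs S), f (select_blocks as bs (insert (k + 1 - 1) S))) \<in> Id_on A"
  let ?N = "sum_list (map length as)"
  let ?s = "select_blocks as bs"
  have rel': "list_all2 (\<lambda>x y. (x, y) \<in> A \<times> A) (as ! i) (bs ! i)" if "i < k + 1" for i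
    using rel[THEN spec, THEN mp, OF that] by (simp only: nth_replicate[OF that])
  have sA: "?s S \<in> nlists ?N A" for S
    by (rule select_blocks_in_nlists) (use len rel' in simp_all)
  have sel: "\<exists>b. \<forall>S T. (b \<in> S \<longleftrightarrow> b \<in> T) \<longrightarrow> ?s S ! i = ?s T ! i" for i
  proof -
    have "\<exists>b. \<forall>S T. (b \<in> S \<longleftrightarrow> b \<in> T) \<longrightarrow>
        concat (map (\<lambda>i. if i \<in> S then bs ! i else as ! i) js) ! i =
        concat (map (\<lambda>i. if i \<in> T then bs ! i else as ! i) js) ! i"
      if "set js \<subseteq> {..<k + 1}" for js
      using that
    proof (induction js arbitrary: i)
      case (Cons j js)
      have lj: "length (bs ! j) = length (as ! j)"
        using list_all2_lengthD[OF rel'[of j]] Cons.prems by simp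
      have hd: "length (if j \<in> S then bs ! j else as ! j) = length (as ! j)" for S
        by (simp add: lj)
      show ?case
      proof (cases "i < length (as ! j)")
        case True
        then show ?thesis unfolding list.map concat.simps nth_append hd
          by (intro exI[of _ j]) simp
      next
        case False
        have "set js \<subseteq> {..<k + 1}" using Cons.prems by simp
        from Cons.IH[OF this, of "i - length (as ! j)"] show ?thesis
          unfolding list.map concat.simps nth_append hd if_not_P[OF False] .
      qed
    qed simp
    from this[of "[0..<length as]"] show ?thesis unfolding select_blocks_def using len
      by (simp add: subset_eq)
  qed
  have s: "block_selection ?N ?s" using sA sel by (simp add: block_selection_def)
  have "\<exists>h. pol ?N h \<and> (\<forall>xs\<in>nlists ?N A. f xs = h xs)"
    by (rule polynomial_imp_pol[of m0]) (rule m0, assumption+, rule f)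
  then obtain h where h: "pol ?N h" "\<forall>xs\<in>nlists ?N A. f xs = h xs" by (elim exE conjE) (rule that)
  have hA: "h (?s S) \<in> A" for S using pol_closed[OF h(1) sA] .
  have fh: "f (?s S) = h (?s S)" for S using h(2) sA by blast
  have eq': "h (?s S) = h (?s (insert k S))" if "S \<subset> {..<k}" for S
  proof -
    have "(f (?s S), f (?s (insert k S))) \<in> Id_on A"
      using eq[THEN spec[of _ S]] that by (simp only: add_diff_cancel_right')
    then show ?thesis by (simp only: fh Id_on_iff)
  qed
  have "h (?s {..<k}) = h (?s {..<k + 1})"
  proof (rule separating[OF hA hA])
    fix i assume i: "i < n"
    define F where "F S = \<psi> i (h (?s S))" for S
    have "junta_sum (p i) d F"
      using deg i h(1) s unfolding degree_le_def F_def by blast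
    from junta_sum_alternating[OF this, of "Suc k"] k
    have "[(\<Sum>S\<in>Pow (insert k {..<k}). (- 1) ^ card S * F S) = 0] (mod int (p i))"
      by (simp add: lessThan_Suc)
    also have "(\<Sum>S\<in>Pow (insert k {..<k}). (- 1) ^ card S * F S)
        = (\<Sum>S\<in>Pow {..<k}. (- 1) ^ card S * (F S - F (insert k S)))"
      by (rule alternating_sum_insert) simp_all
    also have "\<dots> = (\<Sum>S\<in>{{..<k}}. (- 1) ^ card S * (F S - F (insert k S)))"
      
    proof (rule sum.mono_neutral_right)
      show "\<forall>S\<in>Pow {..<k} - {{..<k}}. (- 1) ^ card S * (F S - F (insert k S)) = 0"
      proof
        fix S assume "S \<in> Pow {..<k} - {{..<k}}"
        then have "S \<subset> {..<k}" by blast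
        from eq'[OF this] show "(- 1) ^ card S * (F S - F (insert k S)) = 0" by (simp add: F_def)
      qed
    qed simp_all
    finally have "[(- 1) ^ k * ((- 1) ^ k * (F {..<k} - F (insert k {..<k})))
      = (- 1) ^ k * 0] (mod int (p i))"
      by (intro cong_scalar_left) simp
    then have "[F {..<k} - F (insert k {..<k}) = 0] (mod int (p i))"
      by (simp add: mult.assoc[symmetric] power_add[symmetric])
    then have "[F {..<k} = F (insert k {..<k})] (mod int (p i))"
      unfolding diff_cong_0_iff by (rule cong_sym)
    then show "[\<psi> i (h (?s {..<k})) = \<psi> i (h (?s {..<k + 1}))] (mod int (p i))"
      unfolding F_def by (simp add: lessThan_Suc)
  qed
  then show "(f (?s {..<k + 1 - 1}), f (?s {..<k + 1})) \<in> Id_on A"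
    using hA by (simp only: fh Id_on_iff add_diff_cancel_right')
qed

lemma supernilpotent_malcev_algebra:
  defines "m0 \<equiv> \<lambda>xs\<in>nlists 3 A. m (xs ! 0) (xs ! 1) (xs ! 2)"
  shows "malcev_algebra A {(3, m0)}" "supernilpotent A {(3, m0)}"
proof -
  have m0: "m0 [x, y, z] = m x y z" if "x \<in> A" "y \<in> A" "z \<in> A" for x y z
    using that nlistsI[of "[x, y, z]" 3 A] by (simp add: m0_def)
  have alg: "is_algebra A {(3, m0)}"
    by (auto simp: is_algebra_def m0_def nlistsE_nth_in)
  show "malcev_algebra A {(3, m0)}" unfolding malcev_algebra_def
    using alg m0 by (intro conjI exI[of _ m0]) (auto intro: term_operations.basic)
  obtain d where d: "\<forall>i<n. degree_le i d" using bounded_degree by blast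
  \<comment> \<open>Any \<open>k \<ge> d\<close> would do; the successor ensures \<open>k \<ge> 1\<close>.\<close>
  define k where "k = Suc d"
  let ?\<alpha>s = "replicate (k + 1) (A \<times> A)"
  have "(m0 xs, m0 ys) \<in> Id_on A"
    if "xs \<in> nlists 3 A" "list_all2 (\<lambda>x y. (x, y) \<in> Id_on A) xs ys" for xs ys
  proof -
    have "list_all2 (=) xs ys" using that(2) by (rule list_all2_mono) auto
    then have "xs = ys" by (simp add: list.rel_eq)
    moreover have "m0 xs \<in> A" using alg that(1) by (auto simp: is_algebra_def)
    ultimately show ?thesis by (simp add: Id_on_iff)
  qed
  moreover have "equiv A (Id_on A)"
    by (auto simp: equiv_def refl_on_def sym_def trans_def)
  ultimately have "congruence A {(3, m0)} (Id_on A)" by (simp add: congruence_def)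
  then have "commutator A {(3, m0)} ?\<alpha>s \<subseteq> Id_on A"
    by (rule commutator_least[OF _ centralizes_Id[OF m0 d]]) (simp_all add: k_def)
  moreover have "congruence A {(3, m0)} (commutator A {(3, m0)} ?\<alpha>s)"
    using congruence_total[OF alg] by (intro congruence_commutator alg) simp
  then have "Id_on A \<subseteq> commutator A {(3, m0)} ?\<alpha>s"
    by (auto simp: congruence_def equiv_def refl_on_def)
  ultimately show "supernilpotent A {(3, m0)}"
    unfolding supernilpotent_def by (intro exI[of _ k]) (auto simp: k_def)
qed

end

section \<open>Nilpotent algebras have supernilpotent reducts\<close>

lemma term_operations_congruence:
  assumes \<theta>: "congruence A F \<theta>" and p: "p \<in> term_operations A F"
  shows "\<forall>xs\<in>nlists (fst p) A. \<forall>ys\<in>nlists (fst p) A.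
    list_all2 (\<lambda>x y. (x, y) \<in> \<theta>) xs ys \<longrightarrow> (snd p xs, snd p ys) \<in> \<theta>"
  using p
proof (induction rule: term_operations.induct)
  case (basic p)
  then show ?case using \<theta> by (auto simp: congruence_def split_beta)
next
  case (proj i n)
  then show ?case by (auto simp: list_all2_conv_all_nth)
next
  case (comp k f gs n)
  show ?case
  proof (intro ballI impI)
    fix xs ys
    assume xs: "xs \<in> nlists (fst (n, \<lambda>xs\<in>nlists n A. f (map (\<lambda>g. g xs) gs))) A"
      and ys: "ys \<in> nlists (fst (n, \<lambda>xs\<in>nlists n A. f (map (\<lambda>g. g xs) gs))) A"
      and rel: "list_all2 (\<lambda>x y. (x, y) \<in> \<theta>) xs ys"
    have xy: "xs \<in> nlists n A" "ys \<in> nlists n A" using xs ys by (simp_all only: fst_conv)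
    have g: "(g xs, g ys) \<in> \<theta>" if "g \<in> set gs" for g
      using comp.IH(2) that xy rel by (simp only: fst_conv snd_conv)
    have \<theta>A: "\<theta> \<subseteq> A \<times> A" using \<theta> by (auto simp: congruence_def equiv_def)
    have "map (\<lambda>g. g xs) gs \<in> nlists k A" "map (\<lambda>g. g ys) gs \<in> nlists k A"
      using comp.hyps(2) subsetD[OF \<theta>A g] by (auto intro!: nlistsI)
    moreover have "list_all2 (\<lambda>x y. (x, y) \<in> \<theta>) (map (\<lambda>g. g xs) gs) (map (\<lambda>g. g ys) gs)"
      using g by (simp add: list_all2_conv_all_nth)
    ultimately have "(f (map (\<lambda>g. g xs) gs), f (map (\<lambda>g. g ys) gs)) \<in> \<theta>"
      using comp.IH(1) by (simp only: fst_conv snd_conv)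
    then show "(snd (n, \<lambda>xs\<in>nlists n A. f (map (\<lambda>g. g xs) gs)) xs,
        snd (n, \<lambda>xs\<in>nlists n A. f (map (\<lambda>g. g xs) gs)) ys) \<in> \<theta>"
      by (simp only: snd_conv restrict_apply'[OF xy(1)] restrict_apply'[OF xy(2)])
  qed
qed

context malcev
begin

lemma congruence_imp_cong_m:
  assumes m0: "(3, m0) \<in> term_operations A F"
    and m: "\<And>x y z. x \<in> A \<Longrightarrow> y \<in> A \<Longrightarrow> z \<in> A \<Longrightarrow> m x y z = m0 [x, y, z]"
    and \<theta>: "congruence A F \<theta>"
  shows "cong_m \<theta>"
  unfolding cong_m_def
proof (intro conjI allI impI)
  show eq: "equiv A \<theta>" using \<theta> by (simp add: congruence_def)
  fix x x' y y' z z' assume rel: "(x, x') \<in> \<theta>" "(y, y') \<in> \<theta>" "(z, z') \<in> \<theta>"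
  have "\<theta> \<subseteq> A \<times> A" using eq by (auto simp: equiv_def)
  with rel have A: "x \<in> A" "y \<in> A" "z \<in> A" "x' \<in> A" "y' \<in> A" "z' \<in> A" by auto
  have "[x, y, z] \<in> nlists 3 A" "[x', y', z'] \<in> nlists 3 A"
    by (rule nlistsI; use A in simp)+
  then have "(m0 [x, y, z], m0 [x', y', z']) \<in> \<theta>"
    using term_operations_congruence[OF \<theta> m0] rel by simp
  then show "(m x y z, m x' y' z') \<in> \<theta>" using A by (simp add: m)
qed

lemma nilpotent_central_chain:
  assumes m0: "(3, m0) \<in> term_operations A F"
    and m: "\<And>x y z. x \<in> A \<Longrightarrow> y \<in> A \<Longrightarrow> z \<in> A \<Longrightarrow> m x y z = m0 [x, y, z]"
    and alg: "is_algebra A F" and "nilpotent A F"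
  obtains k \<alpha> where "central_chain k \<alpha>"
proof -
  from \<open>nilpotent A F\<close> obtain k and \<alpha> :: "nat \<Rightarrow> 'a rel" where
    "\<forall>i\<le>k. congruence A F (\<alpha> i)" "\<alpha> 0 = A \<times> A" "\<alpha> k = Id_on A"
    "\<forall>i<k. \<alpha> (Suc i) \<subseteq> \<alpha> i \<and> commutator A F [\<alpha> i, A \<times> A] \<subseteq> \<alpha> (Suc i)"
    unfolding nilpotent_def by (elim exE conjE) (rule that)
  then have \<alpha>: "\<And>i. i \<le> k \<Longrightarrow> congruence A F (\<alpha> i)" "\<alpha> 0 = A \<times> A" "\<alpha> k = Id_on A"
    "\<And>i. i < k \<Longrightarrow> commutator A F [\<alpha> i, A \<times> A] \<subseteq> \<alpha> (Suc i)"
    by simp_all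
  have "central (\<alpha> i) (\<alpha> (Suc i))" if i: "i < k" for i
  proof (rule central_mono[OF _ \<alpha>(4)[OF i]])
    have "congruence A F (\<alpha> i)" using \<alpha>(1) i by simp
    moreover from this have "congruence A F (commutator A F [\<alpha> i, A \<times> A])"
      using congruence_total[OF alg] by (intro congruence_commutator alg) simp
    ultimately show "central (\<alpha> i) (commutator A F [\<alpha> i, A \<times> A])"
      by (intro central_of_centralizes[OF m0 m] centralizes_commutator)
        (simp_all add: congruence_def equiv_def)
  qed
  then have "central_chain k \<alpha>"
    unfolding central_chain_def using \<alpha> congruence_imp_cong_m[OF m0 m] by simp
  then show ?thesis by (rule that)
qed

text \<open>
  The empty carrier is treated apart, since the retractions need a base point \<open>u\<close>.
\<close>

lemma exists_separated_reduct:
  assumes fin: "finite A" and chain: "central_chain k \<alpha>"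
  obtains h n p \<psi> where "separated_coordinates A h n p \<psi>"
    "pol 3 (\<lambda>xs. h (xs ! 0) (xs ! 1) (xs ! 2))"
proof (cases "A = {}")
  case True
  have "separated_coordinates A m 0 (\<lambda>_. 0) (\<lambda>_ _. 0)"
    by unfold_locales (use True in auto)
  then show ?thesis by (rule that) (intro pol_m pol_proj; simp)
next
  case False
  then obtain u where u: "u \<in> A" by blast
  have "cong_m (A \<times> A)" by (rule cong_mI) auto
  from exists_coordinates[OF fin chain this] obtain cs :: "(nat \<times> ('a \<Rightarrow> int)) list" where
    cs: "\<And>i. i < length cs \<Longrightarrow> prime (fst (cs ! i)) \<and>
      affine_on (A \<times> A \<inter> same_coords (set (take i cs))) (fst (cs ! i)) (snd (cs ! i))"
    "A \<times> A \<inter> same_coords (set cs) \<subseteq> Id" by blast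
  define p where "p i = fst (cs ! i)" for i
  define \<phi> where "\<phi> i = snd (cs ! i)" for i
  have same: "A \<times> A \<inter> same_coords (set (take i cs))
      = {(x, y). x \<in> A \<and> y \<in> A \<and> (\<forall>j<i. [\<phi> j x = \<phi> j y] (mod int (p j)))}" if "i \<le> length cs" for i
  proof -
    have "set (take i cs) = (\<lambda>j. (p j, \<phi> j)) ` {..<i}"
      unfolding nth_image[OF that, symmetric] lessThan_atLeast0 p_def \<phi>_def by simp
    then show ?thesis by (auto simp: same_coords_def)
  qed
  interpret C: coordinatized A m "length cs" p \<phi> u
  proof
    show "prime (p i)" if "i < length cs" for i using cs(1)[OF that] by (simp add: p_def)
    show "affine_on {(x, y). x \<in> A \<and> y \<in> A \<and> (\<forall>j<i. [\<phi> j x = \<phi> j y] (mod int (p j)))} (p i) (\<phi> i)"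
      if "i < length cs" for i
      using cs(1)[OF that] same[of i] that by (simp add: p_def \<phi>_def)
    show "x = y" if "x \<in> A" "y \<in> A" "\<And>i. i < length cs \<Longrightarrow> [\<phi> i x = \<phi> i y] (mod int (p i))" for x y
      using cs(2) same[of "length cs"] that by auto
  qed (use fin u in auto)
  have "\<forall>q\<in>C.primes. \<exists>e. C.retraction q e" using C.exists_retraction by blast
  from bchoice[OF this] obtain e where e: "\<forall>q\<in>C.primes. C.retraction q (e q)" by blast
  interpret R: retracted A m "length cs" p \<phi> u e by unfold_locales (use e in blast)
  interpret S: malcev A R.sep by (rule R.malcev_sep)
  have "separated_coordinates A R.sep (length cs) p R.psi"
  proof
    show "prime (p i)" if "i < length cs" for i by (rule C.prime[OF that])
    show "x = y" if "x \<in> A" "y \<in> A" "\<And>i. i < length cs \<Longrightarrow> [R.psi i x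
      = R.psi i y] (mod int (p i))" for x y
      using that by (rule R.psi_separating)
  qed (rule R.psi_sep)
  then show ?thesis by (rule that) (intro R.pol_sep pol_proj; simp)
qed

end

theorem corollary1p3:
  fixes A :: "'a set" and F :: "'a operation set"
  assumes "finite A"
    and "malcev_algebra A F"
    and "nilpotent A F"
  shows "\<exists>G. malcev_algebra A G \<and> supernilpotent A G \<and> polynomial_reduct A F G"
proof -
  from assms(2) obtain m0 where alg: "is_algebra A F" and m0: "(3, m0) \<in> term_operations A F"
    and m0_id: "\<forall>x\<in>A. \<forall>y\<in>A. m0 [x, y, y] = x \<and> m0 [y, y, x] = x"
    unfolding malcev_algebra_def by blast
  interpret malcev A "\<lambda>x y z. m0 [x, y, z]"
  proof
    fix x y z assume "x \<in> A" "y \<in> A" "z \<in> A"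
    then have "[x, y, z] \<in> nlists 3 A" by (intro nlistsI) simp_all
    then show "m0 [x, y, z] \<in> A" 
      by (rule PiE_mem[OF term_operations_closed[OF alg m0, unfolded fst_conv snd_conv]])
  qed (use m0_id in simp_all)
  obtain k \<alpha> where chain: "central_chain k \<alpha>"
    using nilpotent_central_chain[OF m0 refl alg assms(3)] by metis
  obtain h n p \<psi> where
    h: "separated_coordinates A h n p \<psi>" "pol 3 (\<lambda>xs. h (xs ! 0) (xs ! 1) (xs ! 2))"
    by (rule exists_separated_reduct[OF assms(1) chain]) (rule that)
  let ?G = "{(3 :: nat, \<lambda>xs\<in>nlists 3 A. h (xs ! 0) (xs ! 1) (xs ! 2))}"
  have "malcev_algebra A ?G" "supernilpotent A ?G"
    by (rule separated_coordinates.supernilpotent_malcev_algebra[OF h(1)])+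
  moreover have "?G \<subseteq> polynomial_operations A F"
    using pol_imp_polynomial[OF m0 refl h(2)] by simp
  ultimately have "malcev_algebra A ?G \<and> supernilpotent A ?G \<and> polynomial_reduct A F ?G"
    by (simp add: polynomial_reduct_def malcev_algebra_def)
  then show ?thesis by (rule exI)
qed

end
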